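(* Let $n\ge 2$ and let $p,q,s \in B_T^n$. If $m(p,s)=m(q,s)$, then $\{p,q,s\}$ supports a median and $\mu(p,q,s)=m(p,q)$. Conversely, if the three minimal points $m(p,q)$, $m(p,s)$, $m(q,s)$ defined by $p$, $q$, and $s$ are (pairwise) distinct, then $\{p,q,s\}$ does not support a median.
   Context: For $v \in \mathbb{R}^n$ let $\|v\|_T = \sum_{i=1}^n |v_i|$, and let $B_T^n = \{x \in \mathbb{R}^n : \|x\|_T < 1\}$. $\Gamma(p,q)$ is the set of maps $\gamma : [0,1] \to B_T^n$ all of whose components are absolutely continuous, with $\gamma(0)=p$ and $\gamma(1)=q$. The length of such a curve is $\mathcal{L}(\gamma) = \int_0^1 \frac{\|\gamma'(t)\|_T}{1-\|\gamma(t)\|_T^2}\,dt$, and $d(p,q) = \inf_{\gamma\in\Gamma(p,q)} \mathcal{L}(\gamma)$. Minimal point: for real $x,y$ let $\operatorname{sgn}(x) \in \{1,-1,0\}$ be the sign of $x$ (with $\operatorname{sgn}(0)=0$) and let $\ell(x,y) = \operatorname{sgn}(x)\min\{|x|,|y|\}$ if $\operatorname{sgn}(x)=\operatorname{sgn}(y)$, and $\ell(x,y)=0$ otherwise. For $p,q \in B_T^n$, the minimal point $m(p,q) \in B_T^n$ has coordinates $m_i(p,q) = \ell(p_i,q_i)$. Medians: the interval of $p,q\in B_T^n$ is $[p,q]=\{x\in B_T^n : d(p,q)=d(p,x)+d(x,q)\}$. A triple $\{x,y,z\}$ supports a median if $[x,y]\cap[y,z]\cap[z,x]$ consists of exactly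 one point; that point is then the median, denoted $\mu(x,y,z)$. *)

theory Defs
  imports "HOL-Analysis.Analysis"
begin

definition tnorm :: "real ^ 'n \<Rightarrow> real" where
  "tnorm v = (\<Sum>i\<in>UNIV. \<bar>v $ i\<bar>)"

definition tball :: "(real ^ 'n) set" where
  "tball = {x. tnorm x < 1}"

text \<open>Absolute continuity of a real function on the interval from \<open>a\<close> to \<open>b\<close>. The library only has
  absolute continuity of measures, so this is the usual epsilon-delta definition; a pair
  \<open>(u, v)\<close> in \<open>D\<close> stands for the open subinterval with end points \<open>u\<close> and \<open>v\<close>.\<close>

definition abs_continuous_on_Icc :: "real \<Rightarrow> real \<Rightarrow> (real \<Rightarrow> real) \<Rightarrow> bool" where
  "abs_continuous_on_Icc a b f \<longleftrightarrow>
    (\<forall>\<epsilon>>0. \<exists>\<delta>>0. \<forall>D :: (real \<times> real) set.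
      finite D \<and> (\<forall>(u, v)\<in>D. a \<le> u \<and> u < v \<and> v \<le> b) \<and>
      disjoint_family_on (\<lambda>(u, v). {u<..<v}) D \<and> (\<Sum>(u, v)\<in>D. v - u) < \<delta> \<longrightarrow>
      (\<Sum>(u, v)\<in>D. \<bar>f v - f u\<bar>) < \<epsilon>)"

text \<open>Curves are total functions on the reals, but only their values on \<open>{0..1}\<close> matter, both here
  and in \<open>curve_length\<close>.\<close>

definition curves :: "real ^ 'n \<Rightarrow> real ^ 'n \<Rightarrow> (real \<Rightarrow> real ^ 'n) set" where
  "curves p q = {\<gamma>. \<gamma> ` {0..1} \<subseteq> tball \<and>
    (\<forall>i. abs_continuous_on_Icc 0 1 (\<lambda>t. \<gamma> t $ i)) \<and> \<gamma> 0 = p \<and> \<gamma> 1 = q}"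

text \<open>The derivative of an absolutely continuous curve exists almost everywhere on \<open>{0..1}\<close>. The
  unspecified value of \<open>vector_derivative\<close> on the remaining null set does not affect the integral,
  since \<open>lebesgue\<close> is complete.\<close>

definition curve_length :: "(real \<Rightarrow> real ^ 'n) \<Rightarrow> real" where
  "curve_length \<gamma> = (LINT t:{0..1}|lebesgue.
    tnorm (vector_derivative \<gamma> (at t within {0..1})) / (1 - (tnorm (\<gamma> t))\<^sup>2))"

definition tdist :: "real ^ 'n \<Rightarrow> real ^ 'n \<Rightarrow> real" where
  "tdist p q = (INF \<gamma>\<in>curves p q. curve_length \<gamma>)"

definition min_coord :: "real \<Rightarrow> real \<Rightarrow> real" where
  "min_coord x y = (if sgn x = sgn y then sgn x * min \<bar>x\<bar> \<bar>y\<bar> else 0)"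

definition minimal_point :: "real ^ 'n \<Rightarrow> real ^ 'n \<Rightarrow> real ^ 'n" where
  "minimal_point p q = (\<chi> i. min_coord (p $ i) (q $ i))"

definition tinterval :: "real ^ 'n \<Rightarrow> real ^ 'n \<Rightarrow> (real ^ 'n) set" where
  "tinterval p q = {x \<in> tball. tdist p q = tdist p x + tdist x q}"

definition supports_median :: "real ^ 'n \<Rightarrow> real ^ 'n \<Rightarrow> real ^ 'n \<Rightarrow> bool" where
  "supports_median x y z \<longleftrightarrow> (\<exists>!w. w \<in> tinterval x y \<inter> tinterval y z \<inter> tinterval z x)"

text \<open>Meaningful only for triples that support a median.\<close>

definition median :: "real ^ 'n \<Rightarrow> real ^ 'n \<Rightarrow> real ^ 'n \<Rightarrow> real ^ 'n" where
  "median x y z = (THE w. w \<in> tinterval x y \<inter> tinterval y z \<inter> tinterval z x)"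

end

theory Submission
  imports Defs
begin

text \<open>
  Write \<open>|x|\<close> for the norm \<open>\<parallel>x\<parallel>\<^sub>T\<close>. The key is the distance formula
  \<open>d(p, q) = artanh |p| + artanh |q| - 2 artanh |m(p, q)|\<close>. The right-hand side is the length of the path
  that runs straight from \<open>p\<close> to \<open>m(p, q)\<close> and then straight to \<open>q\<close>. It is also a lower
  bound: as a function \<open>\<phi>\<close> of \<open>q\<close> it is Lipschitz with constant \<open>1 / (1 - r\<^sup>2)\<close> on
  \<open>|x| \<le> r\<close>, by convexity of \<open>artanh\<close>, so along an absolutely continuous curve \<open>\<gamma>\<close> the
  derivative of \<open>\<phi> \<circ> \<gamma>\<close> is almost everywhere at most the integrand of the length, and the
  fundamental theorem of calculus for absolutely continuous functions applies.

  Strict convexity of \<open>artanh\<close> then shows that \<open>[p, q]\<close> consists of the points \<open>x\<close> with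
  \<open>m(p, q) \<preceq> x \<preceq> p\<close> or \<open>m(p, q) \<preceq> x \<preceq> q\<close>, where \<open>x \<preceq> y\<close> means that every
  coordinate of \<open>x\<close> lies between \<open>0\<close> and the one of \<open>y\<close>. As \<open>m\<close> is the meet of this order,
  a point common to the three intervals equals one of the three minimal points and lies above the
  other two, which forces these two to coincide.
\<close>

section \<open>Interval families and Vitali coverings\<close>

text \<open>The finite families over which \<open>abs_continuous_on_Icc\<close> quantifies. Only
  open intervals are required to be disjoint, so neighbours may share an end point.\<close>

definition interval_family :: "real \<Rightarrow> real \<Rightarrow> (real \<times> real) set \<Rightarrow> bool" where
  "interval_family a b D \<longleftrightarrow> finite D \<and> (\<forall>(u, v)\<in>D. a \<le> u \<and> u < v \<and> v \<le> b) \<and>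
    disjoint_family_on (\<lambda>(u, v). {u<..<v}) D"

lemma interval_familyD:
  assumes "interval_family a b D"
  shows "finite D" "disjoint_family_on (\<lambda>(u, v). {u<..<v}) D"
    "\<And>u v. (u, v) \<in> D \<Longrightarrow> a \<le> u" "\<And>u v. (u, v) \<in> D \<Longrightarrow> u < v" "\<And>u v. (u, v) \<in> D \<Longrightarrow> v \<le> b"
  using assms unfolding interval_family_def by auto

lemma interval_family_subset:
  "interval_family a b D \<Longrightarrow> E \<subseteq> D \<Longrightarrow> interval_family a b E"
  unfolding interval_family_def
  by (auto intro: finite_subset disjoint_family_on_mono)

lemma interval_family_mono:
  "interval_family a b D \<Longrightarrow> a' \<le> a \<Longrightarrow> b \<le> b' \<Longrightarrow> interval_family a' b' D"
  unfolding interval_family_def by force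

lemma interval_family_measure:
  assumes "interval_family a b D"
  shows "(\<Union>(u, v)\<in>D. {u<..<v}) \<in> lmeasurable"
    and "measure lebesgue (\<Union>(u, v)\<in>D. {u<..<v}) = (\<Sum>(u, v)\<in>D. v - u)"
proof -
  note D = interval_familyD[OF assms]
  show "(\<Union>(u, v)\<in>D. {u<..<v}) \<in> lmeasurable"
    by (intro fmeasurable.finite_UN D) auto
  have "measure lebesgue (\<Union>(u, v)\<in>D. {u<..<v})
      = (\<Sum>i\<in>D. measure lebesgue ((\<lambda>(u, v). {u<..<v}) i))"
    using D(4) by (intro measure_finite_Union D) (fastforce split: prod.splits)+
  also have "\<dots> = (\<Sum>(u, v)\<in>D. v - u)"
    using D(4) by (intro sum.cong refl) (fastforce split: prod.splits)
  finally show "measure lebesgue (\<Union>(u, v)\<in>D. {u<..<v}) = (\<Sum>(u, v)\<in>D. v - u)" .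
qed

text \<open>Up to end points, the complement of a family in \<open>{a..b}\<close> is again a family,
  so the increments of any \<open>F\<close> telescope. One choice of gaps serves every
  \<open>F\<close>: the given function, and also the identity, whose increments are lengths.\<close>

lemma interval_family_gaps:
  assumes "interval_family a b D" "a \<le> b"
  obtains G where "interval_family a b G" "D \<inter> G = {}" "interval_family a b (D \<union> G)"
    "\<And>F :: real \<Rightarrow> real. F b - F a = (\<Sum>(u, v)\<in>D. F v - F u) + (\<Sum>(u, v)\<in>G. F v - F u)"
proof -
  let ?gaps = "\<lambda>D b. \<exists>G. interval_family a b (D \<union> G) \<and> D \<inter> G = {} \<and>
      (\<forall>F :: real \<Rightarrow> real. F b - F a = (\<Sum>(u, v)\<in>D. F v - F u) + (\<Sum>(u, v)\<in>G. F v - F u))"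
  have "finite D"
    using assms interval_familyD by blast
  then have "interval_family a b D \<longrightarrow> a \<le> b \<longrightarrow> ?gaps D b" for b
  \<comment> \<open>The interval with the largest left end point is added last. \<open>b\<close>
    stays arbitrary because the induction hypothesis is then applied on
    \<open>{a..x}\<close>.\<close>
  proof (induction D arbitrary: b rule: finite_ranking_induct[where f = fst])
    case empty
    show ?case
    proof (intro impI)
      assume "a \<le> b"
      then show "?gaps {} b"
        by (intro exI[of _ "if a < b then {(a, b)} else {}"])
          (auto simp: interval_family_def disjoint_family_on_def)
    qed
  next
    case (insert z D)
    obtain x y where z: "z = (x, y)" by force
    show ?case
    proof (cases "z \<in> D")
      case True
      then show ?thesis using insert.IH[of b] by (simp add: insert_absorb)
    next
      case False
      show ?thesis
      proof (intro impI)
        assume fam: "interval_family a b (insert z D)" and "a \<le> b"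
        note fD = interval_familyD[OF fam]
        have xy: "a \<le> x" "x < y" "y \<le> b"
          using fD(3-5)[of x y] z by auto
        have left: "v \<le> x" if "(u, v) \<in> D" for u v
        proof (rule ccontr)
          assume "\<not> v \<le> x"
          moreover have "u \<le> x" "u < v"
            using insert.hyps(2)[OF that] z fD(4)[of u v] that by auto
          moreover have "{u<..<v} \<inter> {x<..<y} = {}"
            using fD(2) that z False unfolding disjoint_family_on_def by fastforce
          \<comment> \<open>If \<open>x < v\<close>, this midpoint would lie in both open
            intervals.\<close>
          ultimately have "(x + min v y) / 2 \<notin> {u<..<v} \<inter> {x<..<y}"
            by auto
          then show False
            using \<open>\<not> v \<le> x\<close> \<open>u \<le> x\<close> xy by (auto simp: min_def split: if_splits)
        qed
        have "interval_family a x D"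
          using fam left unfolding interval_family_def
          by (auto simp: disjoint_family_on_insert False)
        then obtain G where G: "interval_family a x (D \<union> G)" "D \<inter> G = {}"
          "\<And>F :: real \<Rightarrow> real. F x - F a = (\<Sum>(u, v)\<in>D. F v - F u) + (\<Sum>(u, v)\<in>G. F v - F u)"
          using insert.IH[of x] xy by blast
        note GD = interval_familyD[OF G(1)]
        \<comment> \<open>The gap to the right of \<open>y\<close> is added only when it has
          positive length, as members must satisfy \<open>u < v\<close>.\<close>
        define G' where "G' = (if y < b then insert (y, b) G else G)"
        have notG: "(y, b) \<notin> G" "(y, b) \<notin> D" "z \<notin> G" "(y, b) \<noteq> z" if "y < b"
          using GD(5)[of y b] GD(5)[of x y] xy z that by auto
        have notG': "z \<notin> G"
          using GD(5)[of x y] xy z by auto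
        have un: "interval_family a b (insert z D \<union> G')"
        proof -
          have "disjoint_family_on (\<lambda>(u, v). {u<..<v}) (insert z (D \<union> G))"
            using GD(2) GD(5) by (subst disjoint_family_on_insert) (use False notG' z in fastforce)+
          moreover have "disjoint_family_on (\<lambda>(u, v). {u<..<v}) (insert (y,b) (insert z (D \<union> G)))" 
            if "y < b"
            using calculation GD(5) notG[OF that] xy z
            by (subst disjoint_family_on_insert) fastforce+
          ultimately have disj: "disjoint_family_on (\<lambda>(u, v). {u<..<v}) (insert z D \<union> G')"
            by (simp add: G'_def insert_commute)
          have "a \<le> u \<and> u < v \<and> v \<le> b" if "(u, v) \<in> insert z D \<union> G'" for u v
            using GD(3-5)[of u v] xy z that by (auto simp: G'_def split: if_splits)
          moreover have "finite (insert z D \<union> G')"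
            using GD(1) by (simp add: G'_def)
          ultimately show ?thesis
            using disj unfolding interval_family_def by blast
        qed
        have "insert z D \<inter> G' = {}"
          using G(2) notG notG' by (auto simp: G'_def)
        moreover have "F b - F a = (\<Sum>(u, v)\<in>insert z D. F v - F u) + (\<Sum>(u, v)\<in>G'. F v - F u)" 
          for F :: "real \<Rightarrow> real"
          using G(3)[of F] False GD(1) notG xy z by (auto simp: G'_def)
        ultimately show "?gaps (insert z D) b"
          using un by blast
      qed
    qed
  qed
  then obtain G where "interval_family a b (D \<union> G)" "D \<inter> G = {}"
    "\<And>F :: real \<Rightarrow> real. F b - F a = (\<Sum>(u, v)\<in>D. F v - F u) + (\<Sum>(u, v)\<in>G. F v - F u)"
    using assms by blast
  then show thesis
    by (intro that) (auto intro: interval_family_subset)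
qed

text \<open>Vitali's theorem yields countably many disjoint closed intervals covering
  \<open>S\<close> up to a null set. Their total measure is finite, so finitely many of them capture
  all but \<open>e\<close> of it. The set \<open>T\<close> absorbs the null set, the end points and
  the tail.\<close>

lemma Vitali_intervals:
  fixes S U :: "real set"
  assumes "open U" "S \<subseteq> U" "U \<subseteq> {a..b}" "0 < e"
    and fine: "\<And>x e. x \<in> S \<Longrightarrow> 0 < e \<Longrightarrow> \<exists>u v. u \<le> x \<and> x \<le> v \<and> u < v \<and> v - u < e \<and> P u v"
  obtains D T where "interval_family a b D" "\<And>u v. (u, v) \<in> D \<Longrightarrow> {u..v} \<subseteq> U \<and> P u v"
    "T \<in> lmeasurable" "measure lebesgue T \<le> e" "S \<subseteq> T \<union> (\<Union>(u, v)\<in>D. {u<..<v})"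
proof -
  define K where "K = {(u, v). u < v \<and> {u..v} \<subseteq> U \<and> P u v}"
  \<comment> \<open>Centre and radius of a pair, since the covering theorem speaks of balls.\<close>
  define c where "c = (\<lambda>(u, v). (u + v) / 2 :: real)"
  define r where "r = (\<lambda>(u, v). (v - u) / 2 :: real)"
  define I where "I = (\<lambda>(u, v). {u<..<v :: real})"
  have cb: "cball (c i) (r i) = {fst i..snd i}" for i
    by (cases i) (auto simp: c_def r_def cball_eq_atLeastAtMost field_simps)
  obtain C where C: "countable C" "C \<subseteq> K"
     "pairwise (\<lambda>i j. disjnt (cball (c i) (r i)) (cball (c j) (r j))) C"
     "negligible (S - (\<Union>i \<in> C. cball (c i) (r i)))"
  proof (rule Vitali_covering_theorem_cballs[of K r S c])
    show "0 < r i" if "i \<in> K" for i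
      using that by (auto simp: K_def r_def)
    fix x d :: real
    assume "x \<in> S" "0 < d"
    then obtain d' where "0 < d'" "cball x d' \<subseteq> U"
      using assms open_contains_cball by blast
    then obtain u v where uv: "u \<le> x" "x \<le> v" "u < v" "v - u < min d d'" "P u v"
      using fine[OF \<open>x \<in> S\<close>, of "min d d'"] \<open>0 < d\<close> by auto
    have "{u..v} \<subseteq> cball x d'"
      using uv by (auto simp: dist_real_def)
    then show "\<exists>i. i \<in> K \<and> x \<in> cball (c i) (r i) \<and> r i < d"
      using uv \<open>cball x d' \<subseteq> U\<close>
      by (intro exI[of _ "(u, v)"] conjI, unfold cb) (auto simp: K_def r_def)
  qed
  have disj: "disjoint_family_on I C"
    using C(3) unfolding pairwise_def disjoint_family_on_def disjnt_def cb I_def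
    by (fastforce split: prod.splits)
  have sub: "a \<le> u \<and> u < v \<and> v \<le> b" if "(u, v) \<in> C" for u v
  proof -
    have "u < v" "{u..v} \<subseteq> U"
      using C that by (auto simp: K_def)
    then have "u \<in> {a..b}" "v \<in> {a..b}"
      using assms(3) by (meson atLeastAtMost_iff less_eq_real_def order_refl subset_iff)+
    with \<open>u < v\<close> show ?thesis by simp
  qed
  have I_sub: "I i \<subseteq> {a..b}" if "i \<in> C" for i
    using sub[of "fst i" "snd i"] that by (auto simp: I_def split: prod.splits)
  have meas_sub: "(\<Union>(I ` E)) \<in> lmeasurable" if "E \<subseteq> C" for E
  proof (rule bounded_set_imp_lmeasurable)
    show "bounded (\<Union>(I ` E))"
      by (rule bounded_subset[of "{a..b}"]) (use I_sub that in auto)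
    have "open (\<Union>(I ` E))"
      by (intro open_UN) (auto simp: I_def)
    then show "\<Union>(I ` E) \<in> sets lebesgue"
      by auto
  qed
  obtain D' where D': "D' \<subseteq> I ` C" "finite D'" 
    "measure lebesgue (\<Union>(I ` C)) - e < measure lebesgue (\<Union>D')"
  proof (rule measure_countable_Union_approachable[of "I ` C" e "measure lebesgue {a..b}"])
    fix D' assume "D' \<subseteq> I ` C" "finite D'"
    then obtain E where E: "E \<subseteq> C" "D' = I ` E"
      by (meson subset_imageE)
    then show "measure lebesgue (\<Union>D') \<le> measure lebesgue {a..b}"
      using I_sub by (intro measure_mono_fmeasurable) (blast, use meas_sub[of E] in \<open>auto dest: fmeasurableD\<close>)
  qed (use C assms in \<open>auto simp: I_def\<close>)
  then obtain D where D: "D \<subseteq> C" "finite D" "D' = I ` D"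
    by (meson finite_subset_image)
  \<comment> \<open>The countably many end points are added because the conclusion uses open
    intervals.\<close>
  define N where "N = (S - (\<Union>i \<in> C. cball (c i) (r i))) \<union> (fst ` C \<union> snd ` C)"
  define T where "T = N \<union> (\<Union>(I ` C) - \<Union>(I ` D))"
  have N: "negligible N"
    unfolding N_def using C by (intro negligible_Un) (auto simp: negligible_iff_null_sets intro!: countable_imp_null_set_lborel null_sets_completionI)
  have diff: "(\<Union>(I ` C) - \<Union>(I ` D)) \<in> lmeasurable"
    by (intro fmeasurable.Diff meas_sub D order_refl)
  have "measure lebesgue T \<le> measure lebesgue N + measure lebesgue (\<Union>(I ` C) - \<Union>(I ` D))"
    unfolding T_def using N diff
    by (intro measure_Un_le) (auto simp: negligible_imp_sets fmeasurableD)
  also have "\<dots> = measure lebesgue (\<Union>(I ` C)) - measure lebesgue (\<Union>(I ` D))"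
    using D N by (subst measurable_measure_Diff) (auto intro!: meas_sub fmeasurableD simp: negligible_imp_measure0)
  also have "\<dots> \<le> e"
    using D' D by simp
  finally have "measure lebesgue T \<le> e" .
  moreover have "T \<in> lmeasurable"
    unfolding T_def using N diff by (auto intro: negligible_imp_measurable)
  moreover have "interval_family a b D"
    unfolding interval_family_def
    using D sub disj disjoint_family_on_mono[OF D(1), of I] by (auto simp: I_def)
  moreover have "{u..v} \<subseteq> U \<and> P u v" if "(u, v) \<in> D" for u v
    using that D C by (auto simp: K_def)
  moreover have "S \<subseteq> T \<union> (\<Union>(u, v)\<in>D. {u<..<v})"
  proof
    fix x assume "x \<in> S"
    show "x \<in> T \<union> (\<Union>(u, v)\<in>D. {u<..<v})"
    proof (rule ccontr)
      assume x: "\<not> ?thesis"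
      then have "x \<notin> N" "x \<notin> \<Union>(I ` D)"
        by (auto simp: T_def I_def)
      then obtain i where i: "i \<in> C" "x \<in> cball (c i) (r i)"
        using \<open>x \<in> S\<close> unfolding N_def by blast
      then have "x \<noteq> fst i" "x \<noteq> snd i"
        using \<open>x \<notin> N\<close> unfolding N_def by blast+
      then have "x \<in> I i"
        using i unfolding cb I_def by (auto split: prod.splits)
      then show False
        using x i \<open>x \<notin> \<Union>(I ` D)\<close> by (auto simp: T_def)
    qed
  qed
  ultimately show thesis
    using that by blast
qed

section \<open>Absolutely continuous functions\<close>

text \<open>Nonempty disjoint intervals cannot be equal, so distinct indices give distinct pairs and
  the sum can be reindexed. This turns truncated intervals and the pieces of a division into
  interval families.\<close>

lemma interval_family_image:
  assumes "finite I" "\<And>i. i \<in> I \<Longrightarrow> a \<le> u i" "\<And>i. i \<in> I \<Longrightarrow> u i < v i" "\<And>i. i \<in> I \<Longrightarrow> v i \<le> b"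
    and disj: "disjoint_family_on (\<lambda>i. {u i<..<v i}) I"
  shows "interval_family a b ((\<lambda>i. (u i, v i)) ` I)"
    and "(\<Sum>(x, y)\<in>(\<lambda>i. (u i, v i)) ` I. g x y) = (\<Sum>i\<in>I. g (u i) (v i))"
proof -
  have inj: "inj_on (\<lambda>i. (u i, v i)) I"
  proof (rule inj_onI, rule ccontr)
    fix i j assume ij: "i \<in> I" "j \<in> I" "(u i, v i) = (u j, v j)" "i \<noteq> j"
    then have "{u i<..<v i} \<inter> {u j<..<v j} = {}"
      using disj unfolding disjoint_family_on_def by blast
    then show False
      using ij assms(3)[of i] by simp
  qed
  show "(\<Sum>(x, y)\<in>(\<lambda>i. (u i, v i)) ` I. g x y) = (\<Sum>i\<in>I. g (u i) (v i))"
    by (subst sum.reindex[OF inj]) (simp add: o_def)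
  have "disjoint_family_on (\<lambda>(u, v). {u<..<v}) ((\<lambda>i. (u i, v i)) ` I)"
    using disj unfolding disjoint_family_on_def by fastforce
  then show "interval_family a b ((\<lambda>i. (u i, v i)) ` I)"
    using assms unfolding interval_family_def by auto
qed

lemma interval_family_length:
  assumes "interval_family a b D" "a \<le> b"
  shows "(\<Sum>(u, v)\<in>D. v - u) \<le> b - a"
proof -
  obtain G where G: "interval_family a b G" 
    "\<And>F :: real \<Rightarrow> real. F b - F a = (\<Sum>(u, v)\<in>D. F v - F u) + (\<Sum>(u, v)\<in>G. F v - F u)"
    using interval_family_gaps[OF assms] by metis
  have "0 \<le> (\<Sum>(u, v)\<in>G. v - u)"
    using interval_familyD(4)[OF G(1)] by (intro sum_nonneg) fastforce
  then show ?thesis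
    using G(2)[of "\<lambda>x. x"] by simp
qed

lemma abs_continuous_on_Icc_iff:
  "abs_continuous_on_Icc a b F \<longleftrightarrow>
    (\<forall>\<epsilon>>0. \<exists>\<delta>>0. \<forall>D. interval_family a b D \<longrightarrow> (\<Sum>(u, v)\<in>D. v - u) < \<delta> \<longrightarrow>
      (\<Sum>(u, v)\<in>D. \<bar>F v - F u\<bar>) < \<epsilon>)"
  unfolding abs_continuous_on_Icc_def interval_family_def by (simp add: conj_assoc imp_conjL)

text \<open>Families with gaps replace partitions; filling the gaps only adds nonnegative terms, so
  this is the usual notion of bounded variation.\<close>

definition bounded_variation_on_Icc :: "real \<Rightarrow> real \<Rightarrow> (real \<Rightarrow> real) \<Rightarrow> bool" where
  "bounded_variation_on_Icc a b F \<longleftrightarrow>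
    (\<exists>B. \<forall>D. interval_family a b D \<longrightarrow> (\<Sum>(u, v)\<in>D. \<bar>F v - F u\<bar>) \<le> B)"

text \<open>An interval with \<open>c\<close> in its interior is cut at \<open>c\<close>, and the
  triangle inequality bounds its increment by those of the two halves.\<close>

lemma bounded_variation_on_Icc_combine:
  assumes "bounded_variation_on_Icc a c F" "bounded_variation_on_Icc c b F"
  shows "bounded_variation_on_Icc a b F"
proof -
  obtain B1 where B1: "\<And>D. interval_family a c D \<Longrightarrow> (\<Sum>(u, v)\<in>D. \<bar>F v - F u\<bar>) \<le> B1"
    using assms(1) unfolding bounded_variation_on_Icc_def by blast
  obtain B2 where B2: "\<And>D. interval_family c b D \<Longrightarrow> (\<Sum>(u, v)\<in>D. \<bar>F v - F u\<bar>) \<le> B2"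
    using assms(2) unfolding bounded_variation_on_Icc_def by blast
  have "(\<Sum>(u, v)\<in>D. \<bar>F v - F u\<bar>) \<le> B1 + B2" if D: "interval_family a b D" for D
  proof -
    note fD = interval_familyD[OF D]
    \<comment> \<open>An interval across \<open>c\<close> belongs to both \<open>L\<close> and
      \<open>R\<close>; below it is truncated by \<open>min\<close> in the first and by
      \<open>max\<close> in the second.\<close>
    define L where "L = {i \<in> D. fst i < c}"
    define R where "R = {i \<in> D. c < snd i}"
    have fin: "finite L" "finite R"
      using fD by (auto simp: L_def R_def)
    have "disjoint_family_on (\<lambda>i. {fst i<..<min (snd i) c}) L"
      using fD(2) unfolding disjoint_family_on_def L_def by fastforce
    note L' = interval_family_image[OF fin(1) _ _ _ this, of a c]
    have sL: "(\<Sum>i\<in>L. \<bar>F (min (snd i) c) - F (fst i)\<bar>) \<le> B1"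
    proof -
      have "interval_family a c ((\<lambda>i. (fst i, min (snd i) c)) ` L)"
        by (rule L'(1)) (auto simp: L_def fD)
      then have "(\<Sum>(u, v)\<in>(\<lambda>i. (fst i, min (snd i) c)) ` L. \<bar>F v - F u\<bar>) \<le> B1"
        by (rule B1)
      also have "(\<Sum>(u, v)\<in>(\<lambda>i. (fst i, min (snd i) c)) ` L. \<bar>F v - F u\<bar>) = (\<Sum>i\<in>L. \<bar>F (min (snd i) c) - F (fst i)\<bar>)"
        by (rule L'(2)) (auto simp: L_def fD)
      finally show ?thesis .
    qed
    have "disjoint_family_on (\<lambda>i. {max (fst i) c<..<snd i}) R"
      using fD(2) unfolding disjoint_family_on_def R_def by fastforce
    note R' = interval_family_image[OF fin(2) _ _ _ this, of c b]
    have sR: "(\<Sum>i\<in>R. \<bar>F (snd i) - F (max (fst i) c)\<bar>) \<le> B2"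
    proof -
      have "interval_family c b ((\<lambda>i. (max (fst i) c, snd i)) ` R)"
        by (rule R'(1)) (auto simp: R_def fD)
      then have "(\<Sum>(u, v)\<in>(\<lambda>i. (max (fst i) c, snd i)) ` R. \<bar>F v - F u\<bar>) \<le> B2"
        by (rule B2)
      also have "(\<Sum>(u, v)\<in>(\<lambda>i. (max (fst i) c, snd i)) ` R. \<bar>F v - F u\<bar>) = (\<Sum>i\<in>R. \<bar>F (snd i) - F (max (fst i) c)\<bar>)"
        by (rule R'(2)) (auto simp: R_def fD)
      finally show ?thesis .
    qed
    have "(\<Sum>(u, v)\<in>D. \<bar>F v - F u\<bar>) \<le> (\<Sum>i\<in>D. (if fst i < c then \<bar>F (min (snd i) c) - F (fst i)\<bar> else 0)
        + (if c < snd i then \<bar>F (snd i) - F (max (fst i) c)\<bar> else 0))"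
      using fD(4) by (intro sum_mono) (fastforce simp: min_def max_def split: prod.splits)
    also have "\<dots> = (\<Sum>i\<in>L. \<bar>F (min (snd i) c) - F (fst i)\<bar>) + (\<Sum>i\<in>R. \<bar>F (snd i) - F (max (fst i) c)\<bar>)"
      unfolding sum.distrib L_def R_def using fD(1) by (simp add: sum.inter_filter)
    finally show ?thesis
      using sL sR by linarith
  qed
  then show ?thesis
    unfolding bounded_variation_on_Icc_def by blast
qed

text \<open>On a piece shorter than the \<open>\<delta>\<close> that belongs to
  \<open>\<epsilon> = 1\<close> the variation is at most 1, and finitely many such pieces make up
  \<open>{a..b}\<close>.\<close>

lemma abs_continuous_imp_bounded_variation:
  assumes "abs_continuous_on_Icc a b F" "a \<le> b"
  shows "bounded_variation_on_Icc a b F"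
proof -
  obtain \<delta> where "\<delta> > 0" and \<delta>: "\<And>D. interval_family a b D \<Longrightarrow> (\<Sum>(u, v)\<in>D. v - u) < \<delta> \<Longrightarrow>
      (\<Sum>(u, v)\<in>D. \<bar>F v - F u\<bar>) < 1"
    using assms(1) unfolding abs_continuous_on_Icc_iff by (meson zero_less_one)
  \<comment> \<open>Grid points with mesh \<open>\<delta> / 2\<close>, which is strictly below
    \<open>\<delta>\<close>, cut off at \<open>b\<close> so that the grid eventually stays at
    \<open>b\<close>.\<close>
  define x where "x = (\<lambda>n::nat. min b (a + n * (\<delta> / 2)))"
  have bv: "bounded_variation_on_Icc a (x n) F" for n
  proof (induction n)
    case 0
    have "interval_family a (x 0) D \<Longrightarrow> D = {}" for D
      using assms(2) unfolding interval_family_def x_def by fastforce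
    then show ?case
      unfolding bounded_variation_on_Icc_def by (intro exI[of _ 0] allI impI) (metis sum.empty order_refl)
  next
    case (Suc n)
    have "(\<Sum>(u, v)\<in>D. \<bar>F v - F u\<bar>) \<le> 1" if "interval_family (x n) (x (Suc n)) D" for D
    proof -
      have "x n \<le> x (Suc n)" "x (Suc n) - x n \<le> \<delta> / 2" "a \<le> x n" "x (Suc n) \<le> b"
        using \<open>\<delta> > 0\<close> assms(2) by (auto simp: x_def algebra_simps add_divide_distrib min_def)
      then have "(\<Sum>(u, v)\<in>D. v - u) < \<delta>" "interval_family a b D"
        using interval_family_length[OF that] interval_family_mono[OF that] \<open>\<delta> > 0\<close> by auto
      then show ?thesis
        using \<delta> by force
    qed
    then have "bounded_variation_on_Icc (x n) (x (Suc n)) F"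
      unfolding bounded_variation_on_Icc_def by blast
    then show ?case
      using Suc bounded_variation_on_Icc_combine by blast
  qed
  obtain n :: nat where "(b - a) / (\<delta> / 2) < n"
    using reals_Archimedean2 by blast
  then have "x n = b"
    using \<open>\<delta> > 0\<close> by (auto simp: x_def field_simps)
  then show ?thesis
    using bv[of n] by simp
qed

section \<open>Differentiability almost everywhere of absolutely continuous functions\<close>

text \<open>Two Vitali coverings, the second inside the first, both exhaust \<open>E\<close> up to measure \<open>\<epsilon>\<close>, so
  the gaps between them are short and by absolute continuity contribute little to the increments of
  \<open>F\<close>. Hence the increments over both coverings nearly agree, although one is at most \<open>c\<close> and the
  other at least \<open>d\<close> times the outer measure \<open>m\<close> of \<open>E\<close>.\<close>

lemma abs_continuous_derivate_gap_negligible: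
  fixes F :: "real \<Rightarrow> real"
  assumes ac: "abs_continuous_on_Icc a b F" and "a \<le> b" "c < d" and E: "E \<subseteq> {a<..<b}"
    and low: "\<And>x e. x \<in> E \<Longrightarrow> 0 < e \<Longrightarrow>
      \<exists>u v. u \<le> x \<and> x \<le> v \<and> u < v \<and> v - u < e \<and> F v - F u \<le> c * (v - u)"
    and upp: "\<And>x e. x \<in> E \<Longrightarrow> 0 < e \<Longrightarrow>
      \<exists>u v. u \<le> x \<and> x \<le> v \<and> u < v \<and> v - u < e \<and> d * (v - u) \<le> F v - F u"
  shows "negligible E"
proof -
  let ?M = "measure lebesgue ` {T. T \<in> lmeasurable \<and> E \<subseteq> T}"
  define m where "m = Inf ?M"
  have ne: "?M \<noteq> {}"
    using E by (auto intro!: exI[of _ "{a<..<b}"])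
  have bdd: "bdd_below ?M"
    by (rule bdd_belowI[of _ 0]) auto
  have m_le: "m \<le> measure lebesgue T" if "T \<in> lmeasurable" "E \<subseteq> T" for T
    unfolding m_def using that by (intro cInf_lower bdd) auto
  have m_ex: "\<exists>T. T \<in> lmeasurable \<and> E \<subseteq> T \<and> measure lebesgue T < y" if "m < y" for y
    using cInf_lessD[OF ne] that unfolding m_def by blast
  have "m \<le> 0"
  proof (rule ccontr)
    assume "\<not> m \<le> 0"
    then have "0 < m" by simp
    define \<eta> where "\<eta> = (d - c) * m / 4"
    have "0 < \<eta>"
      using \<open>0 < m\<close> \<open>c < d\<close> by (simp add: \<eta>_def)
    then obtain \<delta> where "\<delta> > 0" and \<delta>: "\<And>D. interval_family a b D \<Longrightarrow> (\<Sum>(u, v)\<in>D. v - u) < \<delta> \<Longrightarrow>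
        (\<Sum>(u, v)\<in>D. \<bar>F v - F u\<bar>) < \<eta>"
      using ac unfolding abs_continuous_on_Icc_iff by meson
    \<comment> \<open>The first bound makes the gaps shorter than
      \<open>4 * \<epsilon> < \<delta>\<close>, the second gives \<open>B \<ge> 3 * m / 4\<close>,
      and the third keeps the error \<open>\<bar>c\<bar> * (4 * \<epsilon>)\<close> below
      \<open>(d - c) * m / 8\<close>. With \<open>\<eta>\<close> this yields the contradiction
      \<open>3 / 4 \<le> 1 / 8 + 1 / 4\<close>.\<close>
    define \<epsilon> where "\<epsilon> = min (\<delta> / 8) (min (m / 8) ((d - c) * m / (32 * (\<bar>c\<bar> + 1))))"
    have eps: "0 < \<epsilon>" "\<epsilon> \<le> \<delta> / 8" "\<epsilon> \<le> m / 8" "\<epsilon> \<le> (d - c) * m / (32 * (\<bar>c\<bar> + 1))"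
    proof -
      show "0 < \<epsilon>"
        using \<open>\<delta> > 0\<close> \<open>0 < m\<close> \<open>c < d\<close> by (auto simp: \<epsilon>_def)
    qed (unfold \<epsilon>_def, linarith+)
    obtain T0 where T0: "T0 \<in> lmeasurable" "E \<subseteq> T0" "measure lebesgue T0 < m + \<epsilon>"
      using m_ex[of "m + \<epsilon>"] eps by auto
    obtain U0 where U0: "open U0" "T0 \<subseteq> U0" "U0 - T0 \<in> lmeasurable" "emeasure lebesgue (U0 - T0) < ennreal \<epsilon>"
      using sets_lebesgue_outer_open[of T0 \<epsilon>] T0 eps by (auto simp: fmeasurableD)
    \<comment> \<open>An open superset of \<open>E\<close> whose measure exceeds \<open>m\<close> by
      less than \<open>2 * \<epsilon>\<close>; it caps the total length of the first
      covering.\<close>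
    define U where "U = U0 \<inter> {a<..<b}"
    have U: "open U" "E \<subseteq> U" "U \<subseteq> {a..b}"
      using U0 T0 E by (auto simp: U_def)
    have mU: "measure lebesgue U < m + 2 * \<epsilon>"
    proof -
      have "measure lebesgue (U0 - T0) < \<epsilon>"
        using U0(3,4) eps by (metis emeasure_eq_measure2 ennreal_less_iff measure_nonneg)
      moreover have "measure lebesgue U \<le> measure lebesgue (T0 \<union> (U0 - T0))"
        using U U0 T0 by (intro measure_mono_fmeasurable fmeasurable.Un) (auto simp: U_def)
      moreover have "\<dots> \<le> measure lebesgue T0 + measure lebesgue (U0 - T0)"
        using U0 T0 by (intro measure_Un_le) (auto simp: fmeasurableD)
      ultimately show ?thesis
        using T0 by linarith
    qed
    obtain D1 T1 where D1: "interval_family a b D1" 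
        "\<And>u v. (u, v) \<in> D1 \<Longrightarrow> {u..v} \<subseteq> U \<and> F v - F u \<le> c * (v - u)"
      and T1: "T1 \<in> lmeasurable" "measure lebesgue T1 \<le> \<epsilon>" "E \<subseteq> T1 \<union> (\<Union>(u, v)\<in>D1. {u<..<v})"
      using Vitali_intervals[OF U(1,2,3) eps(1) low] by blast
    define U1 where "U1 = (\<Union>(u, v)\<in>D1. {u<..<v})"
    have U1: "open U1" "U1 \<subseteq> U" "U1 \<subseteq> {a..b}"
    proof -
      show "U1 \<subseteq> U"
        using D1(2) unfolding U1_def by force
      then show "U1 \<subseteq> {a..b}"
        using U(3) by blast
    qed (auto simp: U1_def)
    obtain D2 T2 where D2: "interval_family a b D2" 
        "\<And>u v. (u, v) \<in> D2 \<Longrightarrow> {u..v} \<subseteq> U1 \<and> d * (v - u) \<le> F v - F u"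
      and T2: "T2 \<in> lmeasurable" "measure lebesgue T2 \<le> \<epsilon>" "E \<inter> U1 \<subseteq> T2 \<union> (\<Union>(u, v)\<in>D2. {u<..<v})"
    proof (rule Vitali_intervals[OF U1(1) _ U1(3) eps(1), of "E \<inter> U1" "\<lambda>u v. d * (v - u) \<le> F v - F u"])
      show "E \<inter> U1 \<subseteq> U1"
        by blast
      fix x e :: real
      assume "x \<in> E \<inter> U1" "0 < e"
      then show "\<exists>u v. u \<le> x \<and> x \<le> v \<and> u < v \<and> v - u < e \<and> d * (v - u) \<le> F v - F u"
        using upp by blast
    qed (rule that)
    define A where "A = (\<Sum>(u, v)\<in>D1. v - u)"
    define B where "B = (\<Sum>(u, v)\<in>D2. v - u)"
    have "A \<le> measure lebesgue U"
    proof -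
      have "U \<in> lmeasurable"
        using U by (intro bounded_set_imp_lmeasurable) (auto intro: bounded_subset[of "{a..b}"])
      then show ?thesis
        using U1 interval_family_measure[OF D1(1)] unfolding A_def
        by (metis U1_def fmeasurableD measure_mono_fmeasurable)
    qed
    then have A: "A < m + 2 * \<epsilon>"
      using mU by simp
    have B: "m - 2 * \<epsilon> \<le> B"
    proof -
      let ?V = "\<Union>(u, v)\<in>D2. {u<..<v}"
      note V = interval_family_measure[OF D2(1)]
      \<comment> \<open>\<open>E\<close> is covered by the two exceptional sets and the second
        family, so the outer measure is at most \<open>2 * \<epsilon> + B\<close>.\<close>
      have "m \<le> measure lebesgue (T1 \<union> (T2 \<union> ?V))"
        using T1 T2 V(1) by (intro m_le fmeasurable.Un) (auto simp: U1_def)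
      also have "\<dots> \<le> measure lebesgue T1 + measure lebesgue (T2 \<union> ?V)"
        using T1 T2 V(1) by (intro measure_Un_le) (auto simp: fmeasurableD)
      also have "measure lebesgue (T2 \<union> ?V) \<le> measure lebesgue T2 + measure lebesgue ?V"
        using T1 T2 V(1) by (intro measure_Un_le) (auto simp: fmeasurableD)
      finally show ?thesis
        using T1 T2 V(2) by (simp add: B_def)
    qed
    obtain G1 where G1: "interval_family a b G1" "D1 \<inter> G1 = {}" "interval_family a b (D1 \<union> G1)"
      and eq1: "\<And>F :: real \<Rightarrow> real. F b - F a = (\<Sum>(u, v)\<in>D1. F v - F u) + (\<Sum>(u, v)\<in>G1. F v - F u)"
      using interval_family_gaps[OF D1(1) \<open>a \<le> b\<close>] by metis
    have disj: "{u<..<v} \<inter> {u'<..<v'} = {}" if "(u, v) \<in> D2" "(u', v') \<in> G1" for u v u' v'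
    proof -
      have "{u<..<v} \<subseteq> U1"
        using D2(2)[OF that(1)] by force
      moreover have "U1 \<inter> {u'<..<v'} = {}"
      proof -
        have "{x<..<y} \<inter> {u'<..<v'} = {}" if xy: "(x, y) \<in> D1" for x y
        proof -
          have "(x, y) \<noteq> (u', v')"
            using G1(2) xy \<open>(u', v') \<in> G1\<close> by blast
          then show ?thesis
            using disjoint_family_onD[OF interval_familyD(2)[OF G1(3)], of "(x, y)" "(u', v')"]
              xy \<open>(u', v') \<in> G1\<close> by simp
        qed
        then show ?thesis
          unfolding U1_def by blast
      qed
      ultimately show ?thesis by blast
    qed
    have D2G1: "D2 \<inter> G1 = {}"
    proof (rule ccontr)
      assume "D2 \<inter> G1 \<noteq> {}"
      then obtain u v where "(u, v) \<in> D2" "(u, v) \<in> G1"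
        by auto
      then show False
        using disj[of u v u v] interval_familyD(4)[OF G1(1), of u v] by simp
    qed
    have "disjoint_family_on (\<lambda>(u, v). {u<..<v}) (D2 \<union> G1)"
    proof (unfold disjoint_family_on_def, intro ballI impI)
      fix i j assume ij: "i \<in> D2 \<union> G1" "j \<in> D2 \<union> G1" "i \<noteq> j"
      obtain u v u' v' where "i = (u, v)" "j = (u', v')" by force
      with ij show "(case i of (u, v) \<Rightarrow> {u<..<v}) \<inter> (case j of (u, v) \<Rightarrow> {u<..<v}) = {}"
        using disj[of u v u' v'] disj[of u' v' u v]
          disjoint_family_onD[OF interval_familyD(2)[OF G1(1)], of i j]
          disjoint_family_onD[OF interval_familyD(2)[OF D2(1)], of i j]
        by (simp add: Int_commute) blast
    qed
    then have "interval_family a b (D2 \<union> G1)"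
      using D2(1) G1(1) unfolding interval_family_def by blast
    then obtain G2 where G2: "interval_family a b G2"
      and eq2: "\<And>F :: real \<Rightarrow> real. F b - F a = (\<Sum>(u, v)\<in>D2 \<union> G1. F v - F u) + (\<Sum>(u, v)\<in>G2. F v - F u)"
      using interval_family_gaps[OF _ \<open>a \<le> b\<close>] by metis
    \<comment> \<open>\<open>G2\<close> makes up what \<open>D2\<close> leaves of \<open>D1\<close>.
      Subtracting the two telescoping identities cancels the contribution of
      \<open>G1\<close>.\<close>
    have eq: "(\<Sum>(u, v)\<in>D1. F v - F u) = (\<Sum>(u, v)\<in>D2. F v - F u) + (\<Sum>(u, v)\<in>G2. F v - F u)"
      for F :: "real \<Rightarrow> real"
      using eq1[of F] eq2[of F] D2G1 interval_familyD(1)[OF D2(1)] interval_familyD(1)[OF G1(1)]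
      by (simp add: sum.union_disjoint)
    have "(\<Sum>(u, v)\<in>G2. v - u) < \<delta>"
      using eq[of "\<lambda>x. x"] A B eps \<open>\<delta> > 0\<close> by (simp add: A_def B_def)
    then have "(\<Sum>(u, v)\<in>G2. \<bar>F v - F u\<bar>) < \<eta>"
      using \<delta> G2 by blast
    moreover have "\<bar>\<Sum>(u, v)\<in>G2. F v - F u\<bar> \<le> (\<Sum>(u, v)\<in>G2. \<bar>F v - F u\<bar>)"
      unfolding split_def by (rule sum_abs)
    ultimately have "\<bar>\<Sum>(u, v)\<in>G2. F v - F u\<bar> < \<eta>"
      by linarith
    moreover have "(\<Sum>(u, v)\<in>D1. F v - F u) \<le> c * A"
      unfolding A_def sum_distrib_left using D1(2) by (intro sum_mono) auto
    moreover have "d * B \<le> (\<Sum>(u, v)\<in>D2. F v - F u)"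
      unfolding B_def sum_distrib_left using D2(2) by (intro sum_mono) auto
    \<comment> \<open>The slope bounds give \<open>d * B \<le> c * A + \<eta>\<close>; subtracting
      \<open>c * B\<close> sets the slope gap against the small excess \<open>A - B\<close>.\<close>
    ultimately have "(d - c) * B \<le> c * (A - B) + \<eta>"
      using eq[of F] by (simp add: algebra_simps)
    moreover have "c * (A - B) \<le> \<bar>c\<bar> * (4 * \<epsilon>)"
    proof -
      have "0 \<le> A - B"
        using eq[of "\<lambda>x. x"] interval_familyD(4)[OF G2] 
          sum_nonneg[of G2 "\<lambda>(u, v). v - u"] by (fastforce simp: A_def B_def)
      then have "c * (A - B) \<le> \<bar>c\<bar> * (A - B)"
        by (intro mult_right_mono) auto
      also have "\<dots> \<le> \<bar>c\<bar> * (4 * \<epsilon>)"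
        using A B by (intro mult_left_mono) auto
      finally show ?thesis .
    qed
    moreover have "\<bar>c\<bar> * (4 * \<epsilon>) \<le> (\<bar>c\<bar> + 1) * (4 * \<epsilon>)"
      using eps(1) by (intro mult_right_mono) auto
    moreover have "(\<bar>c\<bar> + 1) * (4 * \<epsilon>) \<le> (d - c) * m / 8"
      using eps(4) by (simp add: field_simps)
    moreover have "(d - c) * (m * 3 / 4) \<le> (d - c) * B"
      using B eps \<open>c < d\<close> by (intro mult_left_mono) auto
    ultimately have "(d - c) * (m * 3 / 4) \<le> (d - c) * m / 8 + (d - c) * m / 4"
      unfolding \<eta>_def by linarith
    moreover have "0 < (d - c) * m"
      using \<open>c < d\<close> \<open>0 < m\<close> by simp
    ultimately show False
      by (simp add: mult.commute)
  qed
  then show ?thesis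
    unfolding negligible_outer using m_ex by (metis le_less_trans)
qed

text \<open>Cover \<open>E\<close> by intervals on which \<open>F\<close> changes by at least
  \<open>K\<close> times the length. The variation bounds \<open>K\<close> times their total length,
  so a large \<open>K\<close> makes them short.\<close>

lemma bounded_variation_infinite_derivate_negligible:
  fixes F :: "real \<Rightarrow> real"
  assumes bv: "bounded_variation_on_Icc a b F" and E: "E \<subseteq> {a<..<b}"
    and inf: "\<And>x K e. x \<in> E \<Longrightarrow> 0 < e \<Longrightarrow>
      \<exists>u v. u \<le> x \<and> x \<le> v \<and> u < v \<and> v - u < e \<and> K * (v - u) \<le> \<bar>F v - F u\<bar>"
  shows "negligible E"
  unfolding negligible_outer_le
proof (intro allI impI)
  fix e :: real
  assume "0 < e"
  obtain B where B: "\<And>D. interval_family a b D \<Longrightarrow> (\<Sum>(u, v)\<in>D. \<bar>F v - F u\<bar>) \<le> B"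
    using bv unfolding bounded_variation_on_Icc_def by blast
  \<comment> \<open>Chosen so that \<open>K * (e / 2) = \<bar>B\<bar> + 1\<close>; the summand 1
    keeps \<open>K\<close> positive.\<close>
  define K where "K = (\<bar>B\<bar> + 1) * 2 / e"
  have "0 < K"
    using \<open>0 < e\<close> by (simp add: K_def)
  obtain D T where D: "interval_family a b D" 
      "\<And>u v. (u, v) \<in> D \<Longrightarrow> {u..v} \<subseteq> {a<..<b} \<and> K * (v - u) \<le> \<bar>F v - F u\<bar>"
    and T: "T \<in> lmeasurable" "measure lebesgue T \<le> e / 2" "E \<subseteq> T \<union> (\<Union>(u, v)\<in>D. {u<..<v})"
  proof (rule Vitali_intervals[of "{a<..<b}" E a b "e / 2" "\<lambda>u v. K * (v - u) \<le> \<bar>F v - F u\<bar>"])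
    fix x e :: real
    assume "x \<in> E" "0 < e"
    then show "\<exists>u v. u \<le> x \<and> x \<le> v \<and> u < v \<and> v - u < e \<and> K * (v - u) \<le> \<bar>F v - F u\<bar>"
      using inf by blast
  qed (use E \<open>0 < e\<close> that in auto)
  let ?V = "\<Union>(u, v)\<in>D. {u<..<v}"
  note V = interval_family_measure[OF D(1)]
  have "K * measure lebesgue ?V \<le> (\<Sum>(u, v)\<in>D. \<bar>F v - F u\<bar>)"
    unfolding V(2) sum_distrib_left using D(2) by (intro sum_mono) auto
  also have "\<dots> \<le> \<bar>B\<bar> + 1"
    using B[OF D(1)] by linarith
  also have "\<bar>B\<bar> + 1 = K * (e / 2)"
    using \<open>0 < e\<close> by (simp add: K_def)
  finally have "measure lebesgue ?V \<le> e / 2"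
    using \<open>0 < K\<close> by simp
  moreover have "measure lebesgue (T \<union> ?V) \<le> measure lebesgue T + measure lebesgue ?V"
    using T V(1) by (intro measure_Un_le) (auto simp: fmeasurableD)
  ultimately have "measure lebesgue (T \<union> ?V) \<le> e"
    using T by linarith
  then show "\<exists>T. E \<subseteq> T \<and> T \<in> lmeasurable \<and> measure lebesgue T \<le> e"
    using T V(1) by (intro exI[of _ "T \<union> ?V"]) auto
qed

text \<open>\<open>near x P\<close> means that \<open>P\<close> holds for all short intervals
  containing \<open>x\<close>, also as an end point. The hypotheses say that slopes near
  \<open>x\<close> are bounded and that no two rationals separate the lower from the upper derivate.
  Restricting to rationals lets the exceptional sets be indexed by countably many pairs.\<close>

lemma differentiable_if_derivates_agree:
  fixes F :: "real \<Rightarrow> real"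
  defines "near \<equiv> \<lambda>x P. \<exists>e>0. \<forall>u v. u \<le> x \<and> x \<le> v \<and> u < v \<and> v - u < e \<longrightarrow> P u v"
  assumes agree: "\<And>c d. c \<in> \<rat> \<Longrightarrow> d \<in> \<rat> \<Longrightarrow> c < d \<Longrightarrow>
      near x (\<lambda>u v. c * (v - u) < F v - F u) \<or> near x (\<lambda>u v. F v - F u < d * (v - u))"
    and bdd: "near x (\<lambda>u v. \<bar>F v - F u\<bar> < K * (v - u))"
  shows "F differentiable (at x)"
proof -
  \<comment> \<open>The supremum of \<open>S\<close> is the lower derivate at \<open>x\<close>; it
    will be the derivative. \<open>S\<close> contains \<open>- K\<close> and is bounded above
    because slopes are eventually below \<open>K\<close>.\<close>
  define S where "S = {c. near x (\<lambda>u v. c * (v - u) < F v - F u)}"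
  have near_conj: "near x (\<lambda>u v. P u v \<and> Q u v)" if P: "near x P" and Q: "near x Q" for P Q
  proof -
    obtain e where e: "0 < e" "\<forall>u v. u \<le> x \<and> x \<le> v \<and> u < v \<and> v - u < e \<longrightarrow> P u v"
      using P unfolding near_def by auto
    obtain e' where e': "0 < e'" "\<forall>u v. u \<le> x \<and> x \<le> v \<and> u < v \<and> v - u < e' \<longrightarrow> Q u v"
      using Q unfolding near_def by auto
    show ?thesis
      unfolding near_def using e e' by (intro exI[of _ "min e e'"]) auto
  qed
  have near_ex: "\<exists>u v. u < v \<and> P u v" if P: "near x P" for P
  proof -
    obtain e where "0 < e" "\<forall>u v. u \<le> x \<and> x \<le> v \<and> u < v \<and> v - u < e \<longrightarrow> P u v"
      using P unfolding near_def by auto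
    then show ?thesis
      by (intro exI[of _ x] exI[of _ "x + e / 2"]) auto
  qed
  have near_mono: "near x Q" if P: "near x P" and "\<And>u v. u < v \<Longrightarrow> P u v \<Longrightarrow> Q u v" for P Q
  proof -
    obtain e where "0 < e" "\<forall>u v. u \<le> x \<and> x \<le> v \<and> u < v \<and> v - u < e \<longrightarrow> P u v"
      using P unfolding near_def by auto
    then show ?thesis
      unfolding near_def using that(2) by (intro exI[of _ e]) simp
  qed
  have "- K \<in> S"
    unfolding S_def by (intro CollectI near_mono[OF bdd]) (auto simp: algebra_simps)
  have upper: "c \<le> d" if c: "c \<in> S" and d: "near x (\<lambda>u v. F v - F u < d * (v - u))" for c d
  proof -
    obtain u v where uv: "u < v" "c * (v - u) < F v - F u" "F v - F u < d * (v - u)"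
      using near_ex[OF near_conj[OF _ d, of "\<lambda>u v. c * (v - u) < F v - F u"]] c
      unfolding S_def by blast
    then have "c * (v - u) < d * (v - u)"
      by linarith
    then show ?thesis
      using uv by simp
  qed
  have "near x (\<lambda>u v. F v - F u < K * (v - u))"
    by (rule near_mono[OF bdd]) auto
  then have S_bdd: "bdd_above S"
    using upper by (intro bdd_aboveI) blast
  define l where "l = Sup S"
  have low: "near x (\<lambda>u v. (l - e) * (v - u) < F v - F u)" if e: "0 < e" for e
  proof -
    obtain c where "c \<in> S" "l - e < c"
      using less_cSupD[of S "l - e"] \<open>- K \<in> S\<close> e unfolding l_def by auto
    then have "near x (\<lambda>u v. c * (v - u) < F v - F u)"
      by (simp add: S_def)
    then show ?thesis
    proof (rule near_mono)
      fix u v :: real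
      assume "u < v" "c * (v - u) < F v - F u"
      moreover have "(l - e) * (v - u) \<le> c * (v - u)"
        using \<open>l - e < c\<close> \<open>u < v\<close> by (intro mult_right_mono) auto
      ultimately show "(l - e) * (v - u) < F v - F u"
        by linarith
    qed
  qed
  have upp: "near x (\<lambda>u v. F v - F u < (l + e) * (v - u))" if e: "0 < e" for e
  proof -
    \<comment> \<open>Two rationals are needed: \<open>c\<close> lies above the supremum and hence
      outside \<open>S\<close>, so the first alternative of \<open>agree\<close> fails and the
      second holds for \<open>d\<close>.\<close>
    obtain c where c: "c \<in> \<rat>" "l < c" "c < l + e"
      using Rats_dense_in_real[of l "l + e"] e by auto
    obtain d where d: "d \<in> \<rat>" "c < d" "d < l + e"
      using Rats_dense_in_real[of c "l + e"] c by auto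
    have "c \<notin> S"
      using cSup_upper[OF _ S_bdd, of c] c unfolding l_def by force
    then have "near x (\<lambda>u v. F v - F u < d * (v - u))"
      using agree[of c d] c d unfolding S_def by blast
    then show ?thesis
    proof (rule near_mono)
      fix u v :: real
      assume "u < v" "F v - F u < d * (v - u)"
      moreover have "d * (v - u) \<le> (l + e) * (v - u)"
        using \<open>d < l + e\<close> \<open>u < v\<close> by (intro mult_right_mono) auto
      ultimately show "F v - F u < (l + e) * (v - u)"
        by linarith
    qed
  qed
  have "((\<lambda>y. (F y - F x) / (y - x)) \<longlongrightarrow> l) (at x)"
    unfolding LIM_eq
  proof (intro allI impI)
    fix r :: real
    assume "0 < r"
    obtain e where "0 < e" and e: "\<And>u v. u \<le> x \<Longrightarrow> x \<le> v \<Longrightarrow> u < v \<Longrightarrow> v - u < e \<Longrightarrow> 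
        (l - r) * (v - u) < F v - F u \<and> F v - F u < (l + r) * (v - u)"
      using near_conj[OF low[OF \<open>0 < r\<close>] upp[OF \<open>0 < r\<close>]] unfolding near_def by auto
    have "\<bar>(F y - F x) / (y - x) - l\<bar> < r" if "y \<noteq> x" "\<bar>y - x\<bar> < e" for y
    proof -
      have "l - r < (F y - F x) / (y - x) \<and> (F y - F x) / (y - x) < l + r"
      proof (cases "x < y")
        case True
        then show ?thesis
          using e[of x y] that by (simp add: pos_less_divide_eq pos_divide_less_eq)
      next
        case False
        then have "y < x" using that by simp
        moreover have "(F y - F x) / (y - x) = (F x - F y) / (x - y)"
          by (metis minus_diff_eq minus_divide_divide)
        ultimately show ?thesis
          using e[of y x] that by (simp add: pos_less_divide_eq pos_divide_less_eq)
      qed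
      then show ?thesis
        by linarith
    qed
    then show "\<exists>s>0. \<forall>y. y \<noteq> x \<and> norm (y - x) < s \<longrightarrow> norm ((F y - F x) / (y - x) - l) < r"
      using \<open>0 < e\<close> by auto
  qed
  then have "(F has_field_derivative l) (at x)"
    unfolding has_field_derivative_iff .
  then show ?thesis
    unfolding real_differentiable_def by blast
qed

text \<open>Where \<open>F\<close> is not differentiable, either the slopes of short intervals are
  unbounded (\<open>E'\<close>) or two rationals separate the derivates (\<open>E\<close>). Each set
  is negligible, and there are countably many.\<close>

theorem abs_continuous_differentiable_ae:
  assumes ac: "abs_continuous_on_Icc a b F" and "a \<le> b"
  shows "negligible {x \<in> {a<..<b}. \<not> F differentiable (at x)}"
proof -
  let ?near = "\<lambda>x P. \<exists>e>0. \<forall>u v. u \<le> x \<and> x \<le> v \<and> u < v \<and> v - u < e \<longrightarrow> P u v"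
  define E where "E = (\<lambda>(c, d). {x \<in> {a<..<b}. \<not> ?near x (\<lambda>u v. c * (v - u) < F v - F u)
    \<and> \<not> ?near x (\<lambda>u v. F v - F u < d * (v - u))})"
  define E' where "E' = {x \<in> {a<..<b}. \<forall>K. \<not> ?near x (\<lambda>u v. \<bar>F v - F u\<bar> < K * (v - u))}"
  have "negligible (E (c, d))" if "c < d" for c d
  proof (rule abs_continuous_derivate_gap_negligible[OF assms that])
    fix x e :: real
    assume x: "x \<in> E (c, d)" and "0 < e"
    have "\<not> ?near x (\<lambda>u v. c * (v - u) < F v - F u)"
      using x by (simp add: E_def)
    then show "\<exists>u v. u \<le> x \<and> x \<le> v \<and> u < v \<and> v - u < e \<and> F v - F u \<le> c * (v - u)"
      using \<open>0 < e\<close> by (meson not_le)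
    have "\<not> ?near x (\<lambda>u v. F v - F u < d * (v - u))"
      using x by (simp add: E_def)
    then show "\<exists>u v. u \<le> x \<and> x \<le> v \<and> u < v \<and> v - u < e \<and> d * (v - u) \<le> F v - F u"
      using \<open>0 < e\<close> by (meson not_le)
  qed (auto simp: E_def)
  then have null: "E i \<in> null_sets lebesgue" if "fst i < snd i" for i
    using that by (metis negligible_iff_null_sets prod.collapse)
  have "countable {i :: real \<times> real. i \<in> \<rat> \<times> \<rat> \<and> fst i < snd i}"
    by (rule countable_subset[of _ "\<rat> \<times> \<rat>"]) (auto simp: countable_rat)
  then have "negligible (\<Union>i\<in>{i \<in> \<rat> \<times> \<rat>. fst i < snd i}. E i)"
    unfolding negligible_iff_null_sets by (rule null_sets_UN') (use null in auto)
  moreover have "negligible E'"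
  proof (rule bounded_variation_infinite_derivate_negligible)
    show "bounded_variation_on_Icc a b F"
      using abs_continuous_imp_bounded_variation assms by blast
    fix x K e :: real
    assume "x \<in> E'" "0 < e"
    then have "\<not> ?near x (\<lambda>u v. \<bar>F v - F u\<bar> < K * (v - u))"
      by (simp add: E'_def)
    then show "\<exists>u v. u \<le> x \<and> x \<le> v \<and> u < v \<and> v - u < e \<and> K * (v - u) \<le> \<bar>F v - F u\<bar>"
      using \<open>0 < e\<close> by (meson not_le)
  qed (auto simp: E'_def)
  ultimately have "negligible ((\<Union>i\<in>{i \<in> \<rat> \<times> \<rat>. fst i < snd i}. E i) \<union> E')"
    by (rule negligible_Un)
  moreover have "{x \<in> {a<..<b}. \<not> F differentiable (at x)}
      \<subseteq> (\<Union>i\<in>{i \<in> \<rat> \<times> \<rat>. fst i < snd i}. E i) \<union> E'"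
  proof (rule subsetI, rule ccontr)
    fix x
    assume x: "x \<in> {x \<in> {a<..<b}. \<not> F differentiable (at x)}"
      and notin: "x \<notin> (\<Union>i\<in>{i \<in> \<rat> \<times> \<rat>. fst i < snd i}. E i) \<union> E'"
    obtain K where K: "?near x (\<lambda>u v. \<bar>F v - F u\<bar> < K * (v - u))"
      using notin x unfolding E'_def by blast
    have "?near x (\<lambda>u v. c * (v - u) < F v - F u) \<or> ?near x (\<lambda>u v. F v - F u < d * (v - u))"
      if "c \<in> \<rat>" "d \<in> \<rat>" "c < d" for c d
    proof -
      have "x \<notin> E (c, d)"
        using notin that by auto
      then show ?thesis
        using x unfolding E_def by auto
    qed
    then have "F differentiable (at x)"
      using K by (intro differentiable_if_derivates_agree) auto
    then show False
      using x by blast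
  qed
  ultimately show ?thesis
    by (rule negligible_subset)
qed

section \<open>The fundamental theorem of calculus for absolutely continuous functions\<close>

lemma abs_continuous_on_Icc_subset:
  assumes "abs_continuous_on_Icc a b F" "a \<le> a'" "b' \<le> b"
  shows "abs_continuous_on_Icc a' b' F"
  using assms interval_family_mono[of a' b' _ a b] unfolding abs_continuous_on_Icc_iff by meson

text \<open>Translates the divisions of gauge integration into interval families. One-point pieces
  have no counterpart there, which is why \<open>g\<close> must vanish on the diagonal.\<close>

lemma division_of_interval_family:
  assumes d: "d division_of i" and "i \<subseteq> {a..b}"
  obtains D where "interval_family a b D" "\<And>u v. (u, v) \<in> D \<Longrightarrow> {u..v} \<in> d"
    "\<And>g :: real \<Rightarrow> real \<Rightarrow> real. (\<And>u. g u u = 0) \<Longrightarrow>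
      (\<Sum>K\<in>d. g (Inf K) (Sup K)) = (\<Sum>(u, v)\<in>D. g u v)"
proof -
  define I where "I = {K \<in> d. Inf K < Sup K}"
  have K: "K = {Inf K..Sup K} \<and> Inf K \<le> Sup K \<and> a \<le> Inf K \<and> Sup K \<le> b" if K: "K \<in> d" for K
  proof -
    obtain u v where uv: "K = cbox u v"
      using division_ofD(4)[OF d K] by blast
    moreover have "K \<noteq> {}" "K \<subseteq> {a..b}"
      using division_ofD(2,3)[OF d K] assms(2) by auto
    ultimately show ?thesis
      by auto
  qed
  have fin: "finite d" "finite I"
    using division_ofD(1)[OF d] by (auto simp: I_def)
  have disj: "disjoint_family_on (\<lambda>K. {Inf K<..<Sup K}) I"
    unfolding disjoint_family_on_def
  proof (intro ballI impI)
    fix K L assume KL: "K \<in> I" "L \<in> I" "K \<noteq> L"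
    then have "interior K \<inter> interior L = {}"
      using division_ofD(5)[OF d] by (auto simp: I_def)
    moreover have "interior K = {Inf K<..<Sup K}" "interior L = {Inf L<..<Sup L}"
      using K[of K] K[of L] KL by (metis (no_types, lifting) I_def interior_atLeastAtMost_real mem_Collect_eq)+
    ultimately show "{Inf K<..<Sup K} \<inter> {Inf L<..<Sup L} = {}"
      by simp
  qed
  note img = interval_family_image[OF fin(2) _ _ _ disj, of a b]
  show thesis
  proof
    show "interval_family a b ((\<lambda>K. (Inf K, Sup K)) ` I)"
      by (rule img(1)) (use K in \<open>auto simp: I_def\<close>)
    show "{u..v} \<in> d" if "(u, v) \<in> (\<lambda>K. (Inf K, Sup K)) ` I" for u v
      using that K unfolding I_def by force
    fix g :: "real \<Rightarrow> real \<Rightarrow> real"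
    assume g: "\<And>u. g u u = 0"
    have "(\<Sum>(u, v)\<in>(\<lambda>K. (Inf K, Sup K)) ` I. g u v) = (\<Sum>K\<in>I. g (Inf K) (Sup K))"
      by (rule img(2)) (use K in \<open>auto simp: I_def\<close>)
    also have "\<dots> = (\<Sum>K\<in>d. g (Inf K) (Sup K))"
    proof (rule sum.mono_neutral_left)
      show "\<forall>K\<in>d - I. g (Inf K) (Sup K) = 0"
        using K g unfolding I_def by (metis (mono_tags, lifting) DiffE antisym_conv2 mem_Collect_eq)
    qed (use fin in \<open>auto simp: I_def\<close>)
    finally show "(\<Sum>K\<in>d. g (Inf K) (Sup K)) = (\<Sum>(u, v)\<in>(\<lambda>K. (Inf K, Sup K)) ` I. g u v)" ..
  qed
qed

text \<open>The gauge keeps the intervals tagged in \<open>N\<close> inside an open set of small measure, so absolute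
  continuity bounds the sum of their increments.\<close>

theorem fundamental_theorem_of_calculus_abs_continuous:
  fixes F f :: "real \<Rightarrow> real"
  assumes ac: "abs_continuous_on_Icc a b F" and "a \<le> b" and N: "negligible N"
    and deriv: "\<And>x. x \<in> {a..b} - N \<Longrightarrow> (F has_vector_derivative f x) (at x within {a..b})"
  shows "(f has_integral (F b - F a)) {a..b}"
proof (cases "a = b")
  case True
  then show ?thesis
    using has_integral_refl(2)[of f b] by simp
next
  case False
  then have "a < b" using \<open>a \<le> b\<close> by simp
  \<comment> \<open>With value 0 on \<open>N\<close>, tags in \<open>N\<close> contribute nothing to
    the Riemann sum; changing \<open>f\<close> on a null set does not affect the integral.\<close>
  define g where "g = (\<lambda>x. if x \<in> N then 0 else f x)"
  have "(g has_integral (F b - F a)) {a..b}"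
    unfolding has_integral_factor_content box_real[symmetric]
  proof safe
    fix e :: real
    assume "e > 0"
    \<comment> \<open>Half of the error budget \<open>e * (b - a)\<close> goes to tags in
      \<open>N\<close>, the other half to the remaining tags.\<close>
    define \<epsilon> where "\<epsilon> = e / 2 * (b - a)"
    have "0 < \<epsilon>"
      using \<open>e > 0\<close> \<open>a < b\<close> by (simp add: \<epsilon>_def)
    then obtain \<delta> where "\<delta> > 0" and \<delta>: "\<And>D. interval_family a b D \<Longrightarrow> (\<Sum>(u, v)\<in>D. v - u) < \<delta> \<Longrightarrow>
        (\<Sum>(u, v)\<in>D. \<bar>F v - F u\<bar>) < \<epsilon>"
      using ac unfolding abs_continuous_on_Icc_iff by meson
    obtain U where U: "open U" "N \<subseteq> U" "U - N \<in> lmeasurable" "emeasure lebesgue (U - N) < ennreal \<delta>"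
      using sets_lebesgue_outer_open[OF negligible_imp_sets[OF N] \<open>\<delta> > 0\<close>] by blast
    have "U = (U - N) \<union> N"
      using U by blast
    then have Um: "U \<in> lmeasurable"
      using U N by (metis fmeasurable.Un negligible_imp_measurable)
    have Ud: "measure lebesgue U < \<delta>"
    proof -
      have "measure lebesgue (U - N) < \<delta>"
        using U(3,4) \<open>\<delta> > 0\<close> by (metis emeasure_eq_measure2 ennreal_less_iff measure_nonneg)
      moreover have "measure lebesgue U \<le> measure lebesgue (U - N) + measure lebesgue N"
        using \<open>U = _\<close> U N by (metis measure_Un_le fmeasurableD negligible_imp_sets)
      ultimately show ?thesis
        using negligible_imp_measure0[OF N] by simp
    qed
    have "\<forall>x. \<exists>d>0. x \<in> {a..b} - N \<longrightarrow>
           (\<forall>y\<in>{a..b}. norm (y - x) < d \<longrightarrow> norm (F y - F x - (y - x) *\<^sub>R f x) \<le> e / 2 * norm (y - x))"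
      using deriv[unfolded has_vector_derivative_def has_derivative_within_alt] \<open>e > 0\<close>
      by (meson half_gt_zero zero_less_one)
    then obtain d where d: "\<And>x. 0 < d x"
      "\<And>x y. \<lbrakk>x \<in> {a..b}; x \<notin> N; y \<in> {a..b}; norm (y - x) < d x\<rbrakk>
         \<Longrightarrow> norm (F y - F x - (y - x) *\<^sub>R f x) \<le> e / 2 * norm (y - x)"
      by (metis DiffI)
    have "\<forall>x. \<exists>r>0. x \<in> N \<longrightarrow> ball x r \<subseteq> U"
      using U by (meson open_contains_ball subset_iff zero_less_one)
    then obtain r where r: "\<And>x. 0 < r x" "\<And>x. x \<in> N \<Longrightarrow> ball x (r x) \<subseteq> U"
      by metis
    \<comment> \<open>At tags in \<open>N\<close> the ball stays inside \<open>U\<close>; at other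
      tags its radius comes from differentiability.\<close>
    define s where "s = (\<lambda>x. if x \<in> N then r x else d x)"
    show "\<exists>d. gauge d \<and> (\<forall>p. p tagged_division_of (cbox a b) \<and> d fine p \<longrightarrow>
      norm ((\<Sum>(x, k)\<in>p. measure lborel k *\<^sub>R g x) - (F b - F a)) \<le> e * measure lborel (cbox a b))"
    proof (rule exI, safe)
      show "gauge (\<lambda>x. ball x (s x))"
        using d(1) r(1) by (intro gauge_ball_dependent) (simp add: s_def)
    next
      fix p
      assume ptag: "p tagged_division_of cbox a b" and finep: "(\<lambda>x. ball x (s x)) fine p"
      have fin: "finite p"
        using ptag by blast
      have ba: "b - a = (\<Sum>(x,K)\<in>p. Sup K - Inf K)" "F b - F a = (\<Sum>(x,K)\<in>p. F (Sup K) - F (Inf K))"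
        using additive_tagged_division_1[where f= "\<lambda>x. x"] additive_tagged_division_1[where f= F]
              \<open>a \<le> b\<close> ptag by auto
      \<comment> \<open>\<open>Inf\<close> and \<open>Sup\<close> of the empty set are unspecified.
        The value 0 there is required for passing from tagged pieces to the pieces
        themselves.\<close>
      define h where "h = (\<lambda>K. if K = {} then 0 else \<bar>F (Sup K) - F (Inf K)\<bar>)"
      define p2 where "p2 = {z \<in> p. fst z \<in> N}"
      \<comment> \<open>Off \<open>N\<close> this is the straddle estimate for a differentiable
        function; on \<open>N\<close>, where \<open>g x = 0\<close>, only the increment
        remains.\<close>
      have bound: "norm (measure lborel K *\<^sub>R g x - (F (Sup K) - F (Inf K)))
          \<le> e / 2 * (Sup K - Inf K) + (if x \<in> N then h K else 0)" if xK: "(x, K) \<in> p" for x K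
      proof -
        obtain u v where k: "K = cbox u v"
          using tagged_division_ofD(4)[OF ptag xK] by blast
        have "x \<in> K" and kab: "K \<subseteq> cbox a b"
          using tagged_division_ofD(2,3)[OF ptag xK] by auto
        then have "u \<le> v"
          unfolding k by auto
        have ball: "K \<subseteq> ball x (s x)"
          using finep xK by blast
        have "u \<in> K" "v \<in> K"
          by (simp_all add: \<open>u \<le> v\<close> k)
        show ?thesis
        proof (cases "x \<in> N")
          case True
          then show ?thesis
            using \<open>u \<le> v\<close> \<open>e > 0\<close> by (simp add: g_def h_def k abs_minus_commute[of "F u"])
        next
          case False
          have "norm ((v - u) *\<^sub>R f x - (F v - F u)) = norm (F u - F x - (u - x) *\<^sub>R f x - (F v - F x - (v - x) *\<^sub>R f x))"
            by (auto simp: algebra_simps)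
          also have "\<dots> \<le> norm (F u - F x - (u - x) *\<^sub>R f x) + norm (F v - F x - (v - x) *\<^sub>R f x)"
            by (rule norm_triangle_ineq4)
          also have "\<dots> \<le> e / 2 * norm (u - x) + e / 2 * norm (v - x)"
            using \<open>x \<in> K\<close> \<open>u \<in> K\<close> \<open>v \<in> K\<close> kab ball False
            by (intro add_mono d) (auto simp: dist_real_def s_def)
          also have "\<dots> = e / 2 * (v - u)"
            using \<open>x \<in> K\<close> by (simp add: k field_simps)
          finally show ?thesis
            using False \<open>u \<le> v\<close> by (simp add: k g_def)
        qed
      qed
      have "norm (\<Sum>(x, K)\<in>p. measure lborel K *\<^sub>R g x - (F (Sup K) - F (Inf K)))
          \<le> (\<Sum>(x, K)\<in>p. e / 2 * (Sup K - Inf K) + (if x \<in> N then h K else 0))"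
        by (rule sum_norm_le) (use bound in auto)
      also have "\<dots> = e / 2 * (b - a) + (\<Sum>(x, K)\<in>p. if x \<in> N then h K else 0)"
        unfolding ba by (simp add: split_def sum.distrib sum_distrib_left)
      also have "(\<Sum>(x, K)\<in>p. if x \<in> N then h K else 0) = (\<Sum>(x, K)\<in>p2. h K)"
        unfolding p2_def using fin by (simp add: split_def sum.inter_filter)
      also have "\<dots> \<le> \<epsilon>"
      proof -
        have p2: "p2 tagged_division_of (\<Union>(snd ` p2))"
          using tagged_partial_division_subset[of p "cbox a b" p2] ptag
          by (intro tagged_partial_division_of_Union_self[of _ "cbox a b"]) (auto simp: p2_def tagged_division_of_def)
        have sub: "\<Union>(snd ` p2) \<subseteq> {a..b}"
          using ptag by (fastforce simp: p2_def)
        have div: "(snd ` p2) division_of (\<Union>(snd ` p2))"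
          using division_of_tagged_division[OF p2] .
        obtain D where D: "interval_family a b D" "\<And>u v. (u, v) \<in> D \<Longrightarrow> {u..v} \<in> snd ` p2"
          "\<And>g :: real \<Rightarrow> real \<Rightarrow> real. (\<And>u. g u u = 0) \<Longrightarrow>
            (\<Sum>K\<in>snd ` p2. g (Inf K) (Sup K)) = (\<Sum>(u, v)\<in>D. g u v)"
          using division_of_interval_family[OF div sub] by metis
        have "(\<Sum>(x, K)\<in>p2. h K) = (\<Sum>K\<in>snd ` p2. h K)"
        proof (rule sum.over_tagged_division_lemma[OF p2])
          show "h (cbox u v) = 0" if "box u v = {}" for u v
          proof (cases "u = v")
            case False
            then have "cbox u v = {}"
              using that by auto
            then show ?thesis
              by (simp add: h_def)
          qed (simp add: h_def)
        qed
        also have "\<dots> = (\<Sum>K\<in>snd ` p2. \<bar>F (Sup K) - F (Inf K)\<bar>)"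
          using division_ofD(3)[OF div] by (intro sum.cong) (auto simp: h_def)
        also have "\<dots> = (\<Sum>(u, v)\<in>D. \<bar>F v - F u\<bar>)"
          using D(3)[of "\<lambda>u v. \<bar>F v - F u\<bar>"] by simp
        also have "\<dots> < \<epsilon>"
        proof (rule \<delta>[OF D(1)])
          have "(\<Union>(u, v)\<in>D. {u<..<v}) \<subseteq> U"
          proof clarify
            fix u v x
            assume "(u, v) \<in> D" and x: "x \<in> {u<..<v}"
            then obtain y where y: "(y, {u..v}) \<in> p" "y \<in> N"
              using D(2)[of u v] by (auto simp: p2_def)
            then have "{u..v} \<subseteq> ball y (r y)"
              using finep unfolding fine_def s_def by fastforce
            then show "x \<in> U"
              using r(2)[OF y(2)] x by force
          qed
          then have "(\<Sum>(u, v)\<in>D. v - u) \<le> measure lebesgue U"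
            using interval_family_measure[OF D(1)] Um by (metis fmeasurableD measure_mono_fmeasurable)
          then show "(\<Sum>(u, v)\<in>D. v - u) < \<delta>"
            using Ud by linarith
        qed
        finally show ?thesis
          by simp
      qed
      finally have "norm (\<Sum>(x, K)\<in>p. measure lborel K *\<^sub>R g x - (F (Sup K) - F (Inf K))) \<le> e * (b - a)"
        by (simp add: \<epsilon>_def algebra_simps)
      then show "norm ((\<Sum>(x, K)\<in>p. measure lborel K *\<^sub>R g x) - (F b - F a)) \<le> e * measure lborel (cbox a b)"
        using \<open>a \<le> b\<close> unfolding ba(2) by (simp add: split_def sum_subtractf)
    qed
  qed
  then show ?thesis
    by (rule has_integral_spike[OF N, rotated]) (simp add: g_def)
qed

text \<open>By the fundamental theorem the integral of \<open>f\<close> over a piece is the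
  increment of \<open>F\<close>, so the sums of their absolute values are bounded by the variation
  of \<open>F\<close>.\<close>

theorem absolutely_integrable_derivative_abs_continuous:
  fixes F f :: "real \<Rightarrow> real"
  assumes ac: "abs_continuous_on_Icc a b F" and "a \<le> b" and N: "negligible N"
    and deriv: "\<And>x. x \<in> {a..b} - N \<Longrightarrow> (F has_vector_derivative f x) (at x within {a..b})"
  shows "f absolutely_integrable_on {a..b}"
proof -
  obtain B where B: "\<And>D. interval_family a b D \<Longrightarrow> (\<Sum>(u, v)\<in>D. \<bar>F v - F u\<bar>) \<le> B"
    using abs_continuous_imp_bounded_variation[OF ac \<open>a \<le> b\<close>]
    unfolding bounded_variation_on_Icc_def by blast
  have "f absolutely_integrable_on cbox a b"
  proof (rule bounded_variation_absolutely_integrable_interval)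
    show "f integrable_on cbox a b"
      using fundamental_theorem_of_calculus_abs_continuous[OF assms] by auto
    fix d assume d: "d division_of cbox a b"
    obtain D where D: "interval_family a b D" 
      "\<And>g :: real \<Rightarrow> real \<Rightarrow> real. (\<And>u. g u u = 0) \<Longrightarrow>
        (\<Sum>K\<in>d. g (Inf K) (Sup K)) = (\<Sum>(u, v)\<in>D. g u v)"
      using division_of_interval_family[OF d, of a b] by (metis box_real(2) order_refl)
    have "(\<Sum>K\<in>d. norm (integral K f)) = (\<Sum>K\<in>d. \<bar>F (Sup K) - F (Inf K)\<bar>)"
    proof (rule sum.cong[OF refl])
      fix K assume K: "K \<in> d"
      then obtain u v where uv: "K = cbox u v" "u \<le> v" "a \<le> u" "v \<le> b"
        using division_ofD(2-4)[OF d K] by fastforce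
      have "(f has_integral (F v - F u)) {u..v}"
      proof (rule fundamental_theorem_of_calculus_abs_continuous[OF _ _ N])
        show "abs_continuous_on_Icc u v F"
          using abs_continuous_on_Icc_subset ac uv by blast
        show "(F has_vector_derivative f x) (at x within {u..v})" if "x \<in> {u..v} - N" for x
          using that uv by (intro has_vector_derivative_within_subset[OF deriv]) auto
      qed fact
      then show "norm (integral K f) = \<bar>F (Sup K) - F (Inf K)\<bar>"
        using uv by (simp add: integral_unique)
    qed
    also have "\<dots> = (\<Sum>(u, v)\<in>D. \<bar>F v - F u\<bar>)"
      using D(2)[of "\<lambda>u v. \<bar>F v - F u\<bar>"] by simp
    finally show "(\<Sum>K\<in>d. norm (integral K f)) \<le> B"
      using B[OF D(1)] by simp
  qed
  then show ?thesis
    by simp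
qed

section \<open>The distance formula\<close>

lemma artanh_diff_strict_increasing:
  fixes x y h :: real
  assumes "0 \<le> x" "x < y" "0 < h" "y + h < 1"
  shows "artanh (x + h) - artanh x < artanh (y + h) - artanh y"
proof (rule DERIV_pos_imp_increasing[OF \<open>x < y\<close>])
  fix t assume t: "x \<le> t" "t \<le> y"
  then have t': "0 \<le> t" "t + h < 1" "t < 1"
    using assms by auto
  have "t\<^sup>2 < (t + h)\<^sup>2" "(t + h)\<^sup>2 < 1"
    using t' assms by (auto intro!: power_strict_mono simp: abs_square_less_1)
  \<comment> \<open>The derivative \<open>1 / (1 - t\<^sup>2)\<close> of \<open>artanh\<close> is
    strictly increasing for \<open>0 \<le> t < 1\<close>. This strict convexity is what makes
    equality in the triangle inequality rigid below.\<close>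
  then have "0 < 1 / (1 - (t + h)\<^sup>2) - 1 / (1 - t\<^sup>2)"
    by (simp add: divide_strict_left_mono)
  moreover have "((\<lambda>t. artanh (t + h) - artanh t) has_real_derivative 1 / (1 - (t + h)\<^sup>2) - 1 / (1 - t\<^sup>2)) (at t)"
    using t' assms
    by (intro DERIV_diff artanh_real_has_field_derivative DERIV_shift[THEN iffD1]) auto
  ultimately show "\<exists>z. ((\<lambda>t. artanh (t + h) - artanh t) has_real_derivative z) (at t) \<and> 0 < z"
    by blast
qed

lemma artanh_strict_mono:
  fixes x y :: real
  assumes "0 \<le> x" "x < y" "y < 1"
  shows "artanh x < artanh y"
proof (rule DERIV_pos_imp_increasing[OF \<open>x < y\<close>])
  fix t assume t: "x \<le> t" "t \<le> y"
  then have "t\<^sup>2 < 1"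
    using assms by (simp add: abs_square_less_1)
  then show "\<exists>z. (artanh has_real_derivative z) (at t) \<and> 0 < z"
    using t assms by (intro exI[of _ "1 / (1 - t\<^sup>2)"]) (auto intro!: derivative_eq_intros)
qed

lemma artanh_mono:
  fixes x y :: real
  assumes "0 \<le> x" "x \<le> y" "y < 1"
  shows "artanh x \<le> artanh y"
  using assms artanh_strict_mono[of x y] by (cases "x = y") auto

text \<open>Convexity moves the interval from \<open>x\<close> to \<open>x'\<close> without
  decreasing the increment; monotonicity then lengthens it up to \<open>y'\<close>.\<close>

lemma artanh_diff_mono:
  fixes x y x' y' :: real
  assumes "0 \<le> x" "x \<le> y" "x' \<le> y'" "y \<le> y'" "y - x \<le> y' - x'" "x \<le> x'" "y' < 1"
  shows "artanh y - artanh x \<le> artanh y' - artanh x'"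
proof -
  have "artanh (x + (y - x)) - artanh x \<le> artanh (x' + (y - x)) - artanh x'"
    using artanh_diff_strict_increasing[of x x' "y - x"] assms
    by (cases "x = x' \<or> x = y") auto
  moreover have "artanh (x' + (y - x)) \<le> artanh y'"
    using assms by (intro artanh_mono) auto
  ultimately show ?thesis by simp
qed

text \<open>Mean value theorem: on \<open>[0, r]\<close> the derivative of \<open>artanh\<close> is
  at most \<open>1 / (1 - r\<^sup>2)\<close>.\<close>

lemma artanh_lipschitz:
  fixes x y r :: real
  assumes "0 \<le> x" "x \<le> y" "y \<le> r" "r < 1"
  shows "artanh y - artanh x \<le> (y - x) / (1 - r\<^sup>2)"
proof (cases "x = y")
  case False
  then have "x < y" using assms by simp
  obtain z where z: "x < z" "z < y" "artanh y - artanh x = (y - x) * (1 / (1 - z\<^sup>2))"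
  proof (rule exE[OF MVT2[of x y artanh "\<lambda>z. 1 / (1 - z\<^sup>2)"]])
    show "(artanh has_real_derivative 1 / (1 - z\<^sup>2)) (at z)" if "x \<le> z" "z \<le> y" for z
      using that assms by (intro artanh_real_has_field_derivative) auto
  qed (use that \<open>x < y\<close> in auto)
  have "z\<^sup>2 \<le> r\<^sup>2" "r\<^sup>2 < 1"
    using z assms by (auto intro!: power_mono simp: abs_square_less_1)
  then have "1 / (1 - z\<^sup>2) \<le> 1 / (1 - r\<^sup>2)"
    by (intro divide_left_mono) auto
  then show ?thesis
    unfolding z(3) using \<open>x < y\<close> by (simp add: divide_inverse mult_left_mono)
qed auto

section \<open>The coordinatewise radial order and its meet\<close>

definition radial_le :: "real \<Rightarrow> real \<Rightarrow> bool" where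
  "radial_le x y \<longleftrightarrow> 0 \<le> x \<and> x \<le> y \<or> y \<le> x \<and> x \<le> 0"

lemma radial_le_refl: "radial_le x x"
  and radial_le_trans: "radial_le x y \<Longrightarrow> radial_le y z \<Longrightarrow> radial_le x z"
  and radial_le_antisym: "radial_le x y \<Longrightarrow> radial_le y x \<Longrightarrow> x = y"
  and radial_le_abs: "radial_le x y \<Longrightarrow> \<bar>x\<bar> \<le> \<bar>y\<bar>"
  and radial_le_abs_eq: "radial_le x y \<Longrightarrow> \<bar>x\<bar> = \<bar>y\<bar> \<Longrightarrow> x = y"
  and radial_le_abs_diff: "radial_le x y \<Longrightarrow> \<bar>y - x\<bar> = \<bar>y\<bar> - \<bar>x\<bar>"
  unfolding radial_le_def by auto

text \<open>A form without signs, convenient for linear case analysis. Where the conditions overlap,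
  both branches give 0.\<close>

lemma min_coord_eq:
  "min_coord x y = (if 0 \<le> x \<and> 0 \<le> y then min x y else if x \<le> 0 \<and> y \<le> 0 then max x y else 0)"
  unfolding min_coord_def sgn_if by (auto simp: min_def max_def)

lemma min_coord_commute: "min_coord x y = min_coord y x"
  unfolding min_coord_eq by (auto simp: min_def max_def)

text \<open>\<open>radial_le\<close> is the tree order on the line with root 0 and the two
  half-lines as branches; \<open>min_coord\<close> is its meet.\<close>

lemma radial_le_min_coord:
  shows "radial_le (min_coord x y) x" "radial_le (min_coord x y) y"
    and "radial_le z x \<Longrightarrow> radial_le z y \<Longrightarrow> radial_le z (min_coord x y)"
  unfolding radial_le_def min_coord_eq by (auto simp: min_def max_def)

lemma abs_diff_min_coord: "\<bar>x - y\<bar> = \<bar>x\<bar> + \<bar>y\<bar> - 2 * \<bar>min_coord x y\<bar>"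
  unfolding min_coord_eq by (auto simp: min_def max_def)

text \<open>Along one branch, the meet with \<open>p\<close> is truncation at a fixed height, and
  truncation does not expand distances.\<close>

lemma abs_min_coord_diff_le:
  "radial_le z x \<Longrightarrow> \<bar>min_coord p x\<bar> - \<bar>min_coord p z\<bar> \<le> \<bar>x\<bar> - \<bar>z\<bar>"
  unfolding radial_le_def min_coord_eq by (auto simp: min_def max_def)

text \<open>Both meets on the left lie below \<open>x\<close>, hence on one branch. The larger is at
  most \<open>\<bar>x\<bar>\<close>; the smaller lies below both \<open>p\<close> and
  \<open>q\<close>, hence below their meet.\<close>

lemma abs_min_coord_sum_le:
  "\<bar>min_coord p x\<bar> + \<bar>min_coord x q\<bar> \<le> \<bar>x\<bar> + \<bar>min_coord p q\<bar>"
  unfolding min_coord_eq by (auto simp: min_def max_def)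

definition orthant_le :: "real ^ 'n \<Rightarrow> real ^ 'n \<Rightarrow> bool" where
  "orthant_le x y \<longleftrightarrow> (\<forall>i. radial_le (x $ i) (y $ i))"

lemma orthant_le_refl: "orthant_le x x"
  and orthant_le_trans: "orthant_le x y \<Longrightarrow> orthant_le y z \<Longrightarrow> orthant_le x z"
  and orthant_le_antisym: "orthant_le x y \<Longrightarrow> orthant_le y x \<Longrightarrow> x = y"
  unfolding orthant_le_def vec_eq_iff
  by (metis radial_le_refl) (metis radial_le_trans, metis radial_le_antisym)

lemma minimal_point_commute: "minimal_point x y = minimal_point y x"
  by (simp add: minimal_point_def vec_eq_iff min_coord_commute)

lemma orthant_le_minimal_point:
  shows orthant_le_minimal_point1: "orthant_le (minimal_point x y) x"
    and orthant_le_minimal_point2: "orthant_le (minimal_point x y) y"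
    and orthant_le_minimal_pointI: "orthant_le z x \<Longrightarrow> orthant_le z y \<Longrightarrow> orthant_le z (minimal_point x y)"
  by (simp_all add: orthant_le_def minimal_point_def radial_le_min_coord)

lemma tnorm_nonneg: "0 \<le> tnorm x"
  by (simp add: tnorm_def sum_nonneg)

lemma tnorm_orthant_le: "orthant_le x y \<Longrightarrow> tnorm x \<le> tnorm y"
  unfolding orthant_le_def tnorm_def by (intro sum_mono radial_le_abs) auto

text \<open>The coordinate differences are nonnegative and sum to 0. This turns equalities of norms
  into equalities of points.\<close>

lemma tnorm_orthant_le_eq:
  assumes "orthant_le x y" "tnorm x = tnorm y"
  shows "x = y"
proof -
  have "(\<Sum>i\<in>UNIV. \<bar>y $ i\<bar> - \<bar>x $ i\<bar>) = 0"
    using assms(2) by (simp add: tnorm_def sum_subtractf)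
  then have "\<forall>i. \<bar>y $ i\<bar> - \<bar>x $ i\<bar> = 0"
    using assms(1) by (subst (asm) sum_nonneg_eq_0_iff) (auto simp: orthant_le_def radial_le_abs)
  then show ?thesis
    using assms(1) unfolding vec_eq_iff orthant_le_def by (metis eq_iff_diff_eq_0 radial_le_abs_eq)
qed

lemma tnorm_diff_orthant_le: "orthant_le x y \<Longrightarrow> tnorm (y - x) = tnorm y - tnorm x"
  unfolding orthant_le_def tnorm_def by (simp add: radial_le_abs_diff sum_subtractf)

text \<open>In this norm the detour through the minimal point is as short as the straight
  segment.\<close>

lemma tnorm_diff_minimal_point: "tnorm (x - y) = tnorm x + tnorm y - 2 * tnorm (minimal_point x y)"
  unfolding tnorm_def minimal_point_def
  by (simp add: abs_diff_min_coord sum_subtractf sum.distrib sum_distrib_left)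

lemma tnorm_minimal_point_diff_le:
  "orthant_le z x \<Longrightarrow> tnorm (minimal_point p x) - tnorm (minimal_point p z) \<le> tnorm x - tnorm z"
  unfolding orthant_le_def tnorm_def minimal_point_def
  by (auto simp flip: sum_subtractf intro!: sum_mono abs_min_coord_diff_le)

lemma tnorm_minimal_point_sum_le:
  "tnorm (minimal_point p x) + tnorm (minimal_point x q) \<le> tnorm x + tnorm (minimal_point p q)"
  unfolding tnorm_def minimal_point_def
  by (auto simp flip: sum.distrib intro!: sum_mono abs_min_coord_sum_le)

lemma tball_orthant_le: "y \<in> tball \<Longrightarrow> orthant_le x y \<Longrightarrow> x \<in> tball"
  using tnorm_orthant_le[of x y] by (simp add: tball_def)

section \<open>The closed formula for the distance\<close>

definition path_dist :: "real ^ 'n \<Rightarrow> real ^ 'n \<Rightarrow> real" where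
  "path_dist p q = artanh (tnorm p) + artanh (tnorm q) - 2 * artanh (tnorm (minimal_point p q))"

lemma path_dist_self: "path_dist p p = 0"
proof -
  have "minimal_point p p = p"
    by (intro orthant_le_antisym orthant_le_minimal_point orthant_le_refl)
  then show ?thesis by (simp add: path_dist_def)
qed

text \<open>The difference is \<open>u - 2 * w\<close>, where \<open>u\<close> and \<open>w\<close>
  are the increments of \<open>artanh\<close> at the norm of the point and of its minimal point with
  \<open>p\<close>. Convexity gives \<open>0 \<le> w \<le> u\<close>, so its absolute value is at
  most \<open>u\<close>.\<close>

lemma path_dist_lipschitz_orthant_le:
  assumes "orthant_le z x" "tnorm x \<le> r" "r < 1"
  shows "\<bar>path_dist p x - path_dist p z\<bar> \<le> tnorm (x - z) / (1 - r\<^sup>2)"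
proof -
  let ?m = "\<lambda>x. tnorm (minimal_point p x)"
  have le: "tnorm z \<le> tnorm x"
    by (rule tnorm_orthant_le[OF assms(1)])
  have mle: "?m z \<le> ?m x"
    by (intro tnorm_orthant_le orthant_le_minimal_pointI orthant_le_minimal_point1 
        orthant_le_trans[OF orthant_le_minimal_point2 assms(1)])
  have mx: "?m x \<le> tnorm x" "?m z \<le> tnorm z"
    by (intro tnorm_orthant_le orthant_le_minimal_point2)+
  have "artanh (?m z) \<le> artanh (?m x)"
    using mle mx assms by (intro artanh_mono) (auto simp: tnorm_nonneg)
  moreover have "artanh (?m x) - artanh (?m z) \<le> artanh (tnorm x) - artanh (tnorm z)"
    using mle le mx assms tnorm_minimal_point_diff_le[OF assms(1), of p]
    by (intro artanh_diff_mono) (auto simp: tnorm_nonneg)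
  moreover have "artanh (tnorm x) - artanh (tnorm z) \<le> (tnorm x - tnorm z) / (1 - r\<^sup>2)"
    using le assms by (intro artanh_lipschitz) (auto simp: tnorm_nonneg)
  ultimately show ?thesis
    unfolding tnorm_diff_orthant_le[OF assms(1)] path_dist_def by linarith
qed

text \<open>Passing through the minimal point keeps the norm below \<open>r\<close>; changing the coordinates one after
  the other would not.\<close>

lemma path_dist_lipschitz:
  assumes "tnorm x \<le> r" "tnorm y \<le> r" "r < 1"
  shows "\<bar>path_dist p x - path_dist p y\<bar> \<le> tnorm (x - y) / (1 - r\<^sup>2)"
proof -
  let ?z = "minimal_point x y"
  have "\<bar>path_dist p x - path_dist p ?z\<bar> \<le> tnorm (x - ?z) / (1 - r\<^sup>2)"
    "\<bar>path_dist p y - path_dist p ?z\<bar> \<le> tnorm (y - ?z) / (1 - r\<^sup>2)"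
    using assms by (intro path_dist_lipschitz_orthant_le orthant_le_minimal_point; simp)+
  moreover have "tnorm (x - y) = tnorm (x - ?z) + tnorm (y - ?z)"
    by (simp add: tnorm_diff_minimal_point[of x y] tnorm_diff_orthant_le orthant_le_minimal_point)
  ultimately show ?thesis
    by (simp add: add_divide_distrib)
qed

text \<open>The equation says that \<open>artanh\<close> grows equally from \<open>M\<close> to
  \<open>a\<close> and from \<open>b\<close> to \<open>X\<close>. The second interval is at least as
  long and, unless both are trivial, starts strictly further right, which contradicts strict
  convexity.\<close>

lemma artanh_sum_eq_cases:
  fixes X M a b :: real
  assumes "0 \<le> M" "M < 1" "0 \<le> a" "a \<le> b" "b \<le> X" "X < 1" "a + b \<le> X + M"
    and eq: "artanh X + artanh M = artanh a + artanh b"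
  shows "X = b \<and> M = a"
proof -
  have "artanh b \<le> artanh X"
    using assms by (intro artanh_mono) auto
  have "M \<le> a"
  proof (rule ccontr)
    assume "\<not> M \<le> a"
    then have "artanh a < artanh M"
      using assms by (intro artanh_strict_mono) auto
    then show False
      using eq \<open>artanh b \<le> artanh X\<close> by simp
  qed
  have "X = b"
  proof (rule ccontr)
    assume "X \<noteq> b"
    then have "artanh b < artanh X"
      using assms by (intro artanh_strict_mono) auto
    then have "M \<noteq> a"
      using eq by auto
    then have "artanh (M + (a - M)) - artanh M < artanh (b + (a - M)) - artanh b"
      using assms \<open>M \<le> a\<close> by (intro artanh_diff_strict_increasing) auto
    moreover have "artanh (b + (a - M)) \<le> artanh X"
      using assms \<open>M \<le> a\<close> by (intro artanh_mono) auto
    ultimately show False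
      using eq by simp
  qed
  moreover have "\<not> M < a"
    using artanh_strict_mono[of M a] assms \<open>X = b\<close> by auto
  ultimately show ?thesis
    using \<open>M \<le> a\<close> by simp
qed

lemma path_dist_between_aux:
  assumes "tnorm (minimal_point x q) = tnorm x" "tnorm (minimal_point p x) = tnorm (minimal_point p q)"
  shows "orthant_le (minimal_point p q) x" "orthant_le x q"
proof -
  have "minimal_point x q = x"
    using assms by (intro tnorm_orthant_le_eq orthant_le_minimal_point)
  then show "orthant_le x q"
    using orthant_le_minimal_point2[of x q] by simp
  then have "orthant_le (minimal_point p x) (minimal_point p q)"
    by (meson orthant_le_minimal_point orthant_le_trans)
  then have "minimal_point p x = minimal_point p q"
    using assms by (intro tnorm_orthant_le_eq)
  then show "orthant_le (minimal_point p q) x"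
    using orthant_le_minimal_point2[of p x] by simp
qed

text \<open>The terms of \<open>p\<close> and \<open>q\<close> cancel, leaving an equation between
  the norms of \<open>x\<close> and the three minimal points to which
  \<open>artanh_sum_eq_cases\<close> applies. Which of the two meets with \<open>x\<close> is larger
  decides whether \<open>x\<close> lies below \<open>p\<close> or below \<open>q\<close>.\<close>

lemma path_dist_between_iff:
  assumes "p \<in> tball" "q \<in> tball" "x \<in> tball"
  shows "path_dist p q = path_dist p x + path_dist x q \<longleftrightarrow>
    orthant_le (minimal_point p q) x \<and> (orthant_le x p \<or> orthant_le x q)"
proof
  let ?X = "tnorm x" and ?M = "tnorm (minimal_point p q)"
  let ?a = "tnorm (minimal_point p x)" and ?b = "tnorm (minimal_point x q)"
  assume "path_dist p q = path_dist p x + path_dist x q"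
  then have eq: "artanh ?X + artanh ?M = artanh ?a + artanh ?b"
    by (simp add: path_dist_def)
  have bounds: "?X < 1" "?M < 1" "?a \<le> ?X" "?b \<le> ?X" "?a + ?b \<le> ?X + ?M"
    using assms tball_orthant_le[OF assms(1) orthant_le_minimal_point1, of q]
    by (auto simp: tball_def intro: tnorm_orthant_le orthant_le_minimal_point tnorm_minimal_point_sum_le)
  show "orthant_le (minimal_point p q) x \<and> (orthant_le x p \<or> orthant_le x q)"
  proof (cases "?a \<le> ?b")
    case True
    then have "?X = ?b" "?M = ?a"
      using artanh_sum_eq_cases[of ?M ?a ?b ?X] bounds eq by (simp_all add: tnorm_nonneg)
    then show ?thesis
      using path_dist_between_aux[of x q p] by simp
  next
    case False
    then have "?X = ?a" "?M = ?b"
      using artanh_sum_eq_cases[of ?M ?b ?a ?X] bounds eq by (simp_all add: tnorm_nonneg)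
    then show ?thesis
      using path_dist_between_aux[of x p q] by (simp add: minimal_point_commute)
  qed
next
  \<comment> \<open>For \<open>x\<close> between the minimal point and \<open>q\<close> both meets
    are known and the formula cancels; the other case follows by exchanging \<open>p\<close> and
    \<open>q\<close>.\<close>
  have eq: "minimal_point x q = x \<and> minimal_point p x = minimal_point p q"
    if "orthant_le (minimal_point p q) x" "orthant_le x q" for p q
    using that
    by (meson orthant_le_antisym orthant_le_minimal_point orthant_le_refl orthant_le_trans)
  assume "orthant_le (minimal_point p q) x \<and> (orthant_le x p \<or> orthant_le x q)"
  then show "path_dist p q = path_dist p x + path_dist x q"
    using eq[of p q] eq[of q p] by (auto simp: path_dist_def minimal_point_commute)
qed

section \<open>Continuity and domination for absolutely continuous functions\<close>

lemma abs_continuous_on_Icc_continuous_on: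
  assumes "abs_continuous_on_Icc a b F"
  shows "continuous_on {a..b} F"
  unfolding continuous_on_iff
proof (intro ballI allI impI)
  fix x e :: real
  assume x: "x \<in> {a..b}" and "0 < e"
  then obtain \<delta> where "\<delta> > 0" and \<delta>: "\<And>D. interval_family a b D \<Longrightarrow> (\<Sum>(u, v)\<in>D. v - u) < \<delta> \<Longrightarrow>
      (\<Sum>(u, v)\<in>D. \<bar>F v - F u\<bar>) < e"
    using assms unfolding abs_continuous_on_Icc_iff by meson
  have small: "\<bar>F v - F u\<bar> < e" if "u < v" "v - u < \<delta>" "a \<le> u" "v \<le> b" for u v
    using \<delta>[of "{(u, v)}"] that by (simp add: interval_family_def disjoint_family_on_def)
  have "dist (F y) (F x) < e" if "y \<in> {a..b}" "dist y x < \<delta>" for y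
    using small[of x y] small[of y x] that x \<open>0 < e\<close> 
    by (cases x y rule: linorder_cases) (auto simp: dist_real_def abs_minus_commute)
  then show "\<exists>d>0. \<forall>x'\<in>{a..b}. dist x' x < d \<longrightarrow> dist (F x') (F x) < e"
    using \<open>\<delta> > 0\<close> by blast
qed

text \<open>Applied to \<open>path_dist p\<close> along a curve, dominated by the coordinates of the
  curve, and to Lipschitz functions, dominated by the identity.\<close>

lemma abs_continuous_on_Icc_dominated:
  fixes F :: "real \<Rightarrow> real" and f :: "'i \<Rightarrow> real \<Rightarrow> real"
  assumes "finite I" and ac: "\<And>i. i \<in> I \<Longrightarrow> abs_continuous_on_Icc a b (f i)"
    and dom: "\<And>u v. a \<le> u \<Longrightarrow> u < v \<Longrightarrow> v \<le> b \<Longrightarrow> \<bar>F v - F u\<bar> \<le> C * (\<Sum>i\<in>I. \<bar>f i v - f i u\<bar>)"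
  shows "abs_continuous_on_Icc a b F"
  unfolding abs_continuous_on_Icc_iff
proof (intro allI impI)
  fix \<epsilon> :: real
  assume "0 < \<epsilon>"
  \<comment> \<open>An equal share of \<open>\<epsilon>\<close> for each index; both increments by 1
    avoid a zero denominator and make the final estimate strict.\<close>
  define \<epsilon>' where "\<epsilon>' = \<epsilon> / ((\<bar>C\<bar> + 1) * (real (card I) + 1))"
  have K: "0 < (\<bar>C\<bar> + 1) * (real (card I) + 1)"
    by (intro mult_pos_pos) auto
  have "0 < \<epsilon>'"
    unfolding \<epsilon>'_def using \<open>0 < \<epsilon>\<close> K by (rule divide_pos_pos)
  then have "\<forall>i\<in>I. \<exists>\<delta>>0. \<forall>D. interval_family a b D \<longrightarrow> (\<Sum>(u, v)\<in>D. v - u) < \<delta> \<longrightarrow>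
      (\<Sum>(u, v)\<in>D. \<bar>f i v - f i u\<bar>) < \<epsilon>'"
    using ac unfolding abs_continuous_on_Icc_iff by blast
  then obtain \<delta> where \<delta>: "\<And>i. i \<in> I \<Longrightarrow> 0 < \<delta> i" "\<And>i D. i \<in> I \<Longrightarrow> interval_family a b D \<Longrightarrow> 
      (\<Sum>(u, v)\<in>D. v - u) < \<delta> i \<Longrightarrow> (\<Sum>(u, v)\<in>D. \<bar>f i v - f i u\<bar>) < \<epsilon>'"
    by metis
  \<comment> \<open>The inserted 1 keeps the minimum meaningful for empty \<open>I\<close>.\<close>
  define \<delta>' where "\<delta>' = Min (insert 1 (\<delta> ` I))"
  have "0 < \<delta>'"
    using \<delta>(1) \<open>finite I\<close> by (auto simp: \<delta>'_def)
  have \<delta>'_le: "\<delta>' \<le> \<delta> i" if "i \<in> I" for i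
    unfolding \<delta>'_def using that \<open>finite I\<close> by (intro Min_le) auto
  have "(\<Sum>(u, v)\<in>D. \<bar>F v - F u\<bar>) < \<epsilon>"
    if D: "interval_family a b D" "(\<Sum>(u, v)\<in>D. v - u) < \<delta>'" for D
  proof -
    have "(\<Sum>(u, v)\<in>D. \<bar>F v - F u\<bar>) \<le> (\<Sum>(u, v)\<in>D. C * (\<Sum>i\<in>I. \<bar>f i v - f i u\<bar>))"
      using dom interval_familyD[OF D(1)] by (intro sum_mono) (auto split: prod.splits)
    also have "\<dots> = C * (\<Sum>i\<in>I. \<Sum>(u, v)\<in>D. \<bar>f i v - f i u\<bar>)"
      by (subst sum.swap) (simp add: split_def sum_distrib_left)
    also have "\<dots> \<le> \<bar>C\<bar> * (\<Sum>i\<in>I. \<Sum>(u, v)\<in>D. \<bar>f i v - f i u\<bar>)"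
      by (intro mult_right_mono sum_nonneg) (auto split: prod.splits)
    also have "\<dots> \<le> \<bar>C\<bar> * (\<Sum>i\<in>I. \<epsilon>')"
      using \<delta>(2)[OF _ D(1)] \<delta>'_le D(2) by (intro mult_left_mono sum_mono) force+
    also have "\<dots> < (\<bar>C\<bar> + 1) * ((real (card I) + 1) * \<epsilon>')"
      using \<open>0 < \<epsilon>'\<close> by (simp add: algebra_simps add_pos_nonneg)
    also have "\<dots> = \<epsilon>"
      unfolding \<epsilon>'_def mult.assoc[symmetric] using K by (metis less_irrefl nonzero_mult_div_cancel_left times_divide_eq_right)
    finally show ?thesis .
  qed
  then show "\<exists>\<delta>>0. \<forall>D. interval_family a b D \<longrightarrow> (\<Sum>(u, v)\<in>D. v - u) < \<delta> \<longrightarrow>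
      (\<Sum>(u, v)\<in>D. \<bar>F v - F u\<bar>) < \<epsilon>"
    using \<open>0 < \<delta>'\<close> by blast
qed

lemma abs_continuous_on_Icc_lipschitz:
  fixes F :: "real \<Rightarrow> real"
  assumes "\<And>u v. a \<le> u \<Longrightarrow> u < v \<Longrightarrow> v \<le> b \<Longrightarrow> \<bar>F v - F u\<bar> \<le> C * (v - u)"
  shows "abs_continuous_on_Icc a b F"
proof (rule abs_continuous_on_Icc_dominated[of "{()}" a b "\<lambda>_ x. x" F C])
  show "abs_continuous_on_Icc a b (\<lambda>x. x)"
    unfolding abs_continuous_on_Icc_iff
  proof (intro allI impI)
    fix \<epsilon> :: real
    assume "0 < \<epsilon>"
    have "(\<Sum>(u, v)\<in>D. \<bar>v - u\<bar>) = (\<Sum>(u, v)\<in>D. v - u)" if "interval_family a b D" for D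
      using interval_familyD(4)[OF that] by (intro sum.cong refl) fastforce
    then show "\<exists>\<delta>>0. \<forall>D. interval_family a b D \<longrightarrow> (\<Sum>(u, v)\<in>D. v - u) < \<delta> \<longrightarrow>
        (\<Sum>(u, v)\<in>D. \<bar>v - u\<bar>) < \<epsilon>"
      using \<open>0 < \<epsilon>\<close> by (intro exI[of _ \<epsilon>]) simp
  qed
qed (use assms in auto)

section \<open>Lengths of curves\<close>

lemma tendsto_tnorm: "(f \<longlongrightarrow> a) F \<Longrightarrow> ((\<lambda>x. tnorm (f x)) \<longlongrightarrow> tnorm a) F"
  unfolding tnorm_def by (intro tendsto_intros)

lemma continuous_on_tnorm: "continuous_on A f \<Longrightarrow> continuous_on A (\<lambda>x. tnorm (f x))"
  unfolding continuous_on_def by (blast intro: tendsto_tnorm)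

lemma has_vector_derivative_vecI:
  fixes f :: "real \<Rightarrow> real ^ 'n"
  assumes "\<And>i. ((\<lambda>t. f t $ i) has_vector_derivative D $ i) (at x within S)"
  shows "(f has_vector_derivative D) (at x within S)"
  unfolding has_vector_derivative_def has_derivative_within
proof (intro conjI vec_tendstoI)
  fix i
  show "((\<lambda>y. ((1 / norm (y - x)) *\<^sub>R (f y - (f x + (y - x) *\<^sub>R D))) $ i) \<longlongrightarrow> 0 $ i) (at x within S)"
    using assms[of i] unfolding has_vector_derivative_def has_derivative_within by simp
qed (auto intro: bounded_linear_scaleR_left)

text \<open>For each \<open>s\<close> the Lipschitz bound is used with the radius
  \<open>max (tnorm (\<gamma> s)) (tnorm (\<gamma> t))\<close>. As \<open>s\<close> tends to
  \<open>t\<close> this radius tends to \<open>tnorm (\<gamma> t)\<close>, so the limit has exactly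
  the weight of the length integrand.\<close>

lemma path_dist_derivative_le:
  fixes \<gamma> :: "real \<Rightarrow> real ^ 'n"
  assumes \<gamma>: "(\<gamma> has_vector_derivative v) (at t within S)"
    and \<phi>: "((\<lambda>s. path_dist p (\<gamma> s)) has_vector_derivative l) (at t within S)"
    and S: "\<gamma> ` S \<subseteq> tball" "t \<in> S" "at t within S \<noteq> bot"
  shows "l \<le> tnorm v / (1 - (tnorm (\<gamma> t))\<^sup>2)"
proof -
  let ?q = "\<lambda>s. (\<Sum>i\<in>UNIV. \<bar>(\<gamma> s $ i - \<gamma> t $ i) / (s - t)\<bar>)"
  let ?w = "\<lambda>s. 1 - (max (tnorm (\<gamma> s)) (tnorm (\<gamma> t)))\<^sup>2"
  have ball: "tnorm (\<gamma> s) < 1" if "s \<in> S" for s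
    using S that by (auto simp: tball_def)
  have "((\<lambda>s. \<gamma> s $ i) has_real_derivative v $ i) (at t within S)" for i
    using bounded_linear.has_vector_derivative[OF bounded_linear_vec_nth \<gamma>]
    by (simp add: has_real_derivative_iff_has_vector_derivative)
  then have "(?q \<longlongrightarrow> (\<Sum>i\<in>UNIV. \<bar>v $ i\<bar>)) (at t within S)"
    unfolding has_field_derivative_iff by (intro tendsto_sum tendsto_rabs)
  moreover have "((\<lambda>s. tnorm (\<gamma> s)) \<longlongrightarrow> tnorm (\<gamma> t)) (at t within S)"
    using has_vector_derivative_continuous[OF \<gamma>] by (intro tendsto_tnorm) (simp add: continuous_within)
  then have "(?w \<longlongrightarrow> 1 - (max (tnorm (\<gamma> t)) (tnorm (\<gamma> t)))\<^sup>2) (at t within S)"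
    by (intro tendsto_intros)
  moreover have "1 - (tnorm (\<gamma> t))\<^sup>2 \<noteq> 0"
    using ball[OF S(2)] tnorm_nonneg[of "\<gamma> t"] by (auto simp: power2_eq_1_iff)
  ultimately have lim: "((\<lambda>s. ?q s / ?w s) \<longlongrightarrow> tnorm v / (1 - (tnorm (\<gamma> t))\<^sup>2)) (at t within S)"
    unfolding tnorm_def[of v] by (intro tendsto_divide) auto
  have "((\<lambda>s. (path_dist p (\<gamma> s) - path_dist p (\<gamma> t)) / (s - t)) \<longlongrightarrow> l) (at t within S)"
    using \<phi> by (simp add: has_field_derivative_iff flip: has_real_derivative_iff_has_vector_derivative)
  then show ?thesis
  proof (rule tendsto_le[OF S(3) lim])
    have "(path_dist p (\<gamma> s) - path_dist p (\<gamma> t)) / (s - t) \<le> ?q s / ?w s" if s: "s \<in> S" for s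
    proof -
      have "\<bar>path_dist p (\<gamma> s) - path_dist p (\<gamma> t)\<bar> \<le> tnorm (\<gamma> s - \<gamma> t) / ?w s"
        using ball s S by (intro path_dist_lipschitz) auto
      then have "\<bar>path_dist p (\<gamma> s) - path_dist p (\<gamma> t)\<bar> / \<bar>s - t\<bar> \<le> tnorm (\<gamma> s - \<gamma> t) / ?w s / \<bar>s - t\<bar>"
        by (intro divide_right_mono) auto
      also have "\<dots> = ?q s / ?w s"
        by (simp add: tnorm_def sum_divide_distrib mult.commute)
      finally show ?thesis
        by (simp flip: abs_divide)
    qed
    then show "\<forall>\<^sub>F s in at t within S. (path_dist p (\<gamma> s) - path_dist p (\<gamma> t)) / (s - t) \<le> ?q s / ?w s"
      by (simp add: eventually_at_filter)
  qed
qed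

lemma curves_differentiable_ae:
  assumes "\<gamma> \<in> curves p q"
  obtains N where "negligible N" "{0, 1} \<subseteq> N"
    "\<And>t. t \<in> {0..1} - N \<Longrightarrow>
      (\<gamma> has_vector_derivative vector_derivative \<gamma> (at t within {0..1})) (at t within {0..1})"
proof
  \<comment> \<open>The end points are included because differentiability is known only inside the
    open interval.\<close>
  define N where "N = {0, 1} \<union> (\<Union>i. {t \<in> {0<..<1}. \<not> (\<lambda>t. \<gamma> t $ i) differentiable (at t)})"
  have "negligible {t \<in> {0<..<1}. \<not> (\<lambda>t. \<gamma> t $ i) differentiable (at t)}" for i
    using assms by (intro abs_continuous_differentiable_ae) (auto simp: curves_def)
  then show "negligible N"
    unfolding N_def by (intro negligible_Un negligible_Union) auto
  show "{0, 1} \<subseteq> N"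
    by (auto simp: N_def)
  fix t :: real
  assume t: "t \<in> {0..1} - N"
  have "\<forall>i. \<exists>D. ((\<lambda>t. \<gamma> t $ i) has_vector_derivative D) (at t)"
  proof
    fix i
    have "(\<lambda>t. \<gamma> t $ i) differentiable (at t)"
      using t by (auto simp: N_def)
    then show "\<exists>D. ((\<lambda>t. \<gamma> t $ i) has_vector_derivative D) (at t)"
      by (auto simp: real_differentiable_def has_real_derivative_iff_has_vector_derivative)
  qed
  then obtain D where "\<And>i. ((\<lambda>t. \<gamma> t $ i) has_vector_derivative D i) (at t)"
    by metis
  then have "(\<gamma> has_vector_derivative (\<chi> i. D i)) (at t)"
    by (intro has_vector_derivative_vecI) simp
  then have "(\<gamma> has_vector_derivative (\<chi> i. D i)) (at t within {0..1})"
    by (rule has_vector_derivative_at_within)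
  moreover from this have "vector_derivative \<gamma> (at t within {0..1}) = (\<chi> i. D i)"
    using t by (intro vector_derivative_within_closed_interval) auto
  ultimately show "(\<gamma> has_vector_derivative vector_derivative \<gamma> (at t within {0..1})) (at t within {0..1})"
    by simp
qed

lemma curves_continuous_on: "\<gamma> \<in> curves p q \<Longrightarrow> continuous_on {0..1} \<gamma>"
  using abs_continuous_on_Icc_continuous_on
  unfolding curves_def continuous_on_def by (intro ballI vec_tendstoI) blast

text \<open>By compactness a curve stays in a smaller closed ball, where the weight of the length
  integrand is bounded.\<close>

lemma curves_tnorm_bound:
  assumes "\<gamma> \<in> curves p q"
  obtains r where "0 \<le> r" "r < 1" "\<And>t. t \<in> {0..1} \<Longrightarrow> tnorm (\<gamma> t) \<le> r"
proof -
  obtain t0 where "t0 \<in> {0..1}" "\<And>t. t \<in> {0..1} \<Longrightarrow> tnorm (\<gamma> t) \<le> tnorm (\<gamma> t0)"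
    using continuous_attains_sup[of "{0..1 :: real}" "\<lambda>t. tnorm (\<gamma> t)"]
      continuous_on_tnorm[OF curves_continuous_on[OF assms]] by auto
  then show thesis
    using that[of "tnorm (\<gamma> t0)"] assms tnorm_nonneg[of "\<gamma> t0"] by (fastforce simp: curves_def tball_def)
qed

text \<open>The norm of the derivative is absolutely integrable coordinate by coordinate, and the
  weight is continuous and bounded. This rules out the default value 0 that the integral takes on
  functions that are not integrable.\<close>

lemma curve_integrand_absolutely_integrable:
  assumes \<gamma>: "\<gamma> \<in> curves p q"
  shows "(\<lambda>t. tnorm (vector_derivative \<gamma> (at t within {0..1})) / (1 - (tnorm (\<gamma> t))\<^sup>2))
    absolutely_integrable_on {0..1}"
proof -
  let ?D = "\<lambda>t. vector_derivative \<gamma> (at t within {0..1})"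
  let ?w = "\<lambda>t. 1 / (1 - (tnorm (\<gamma> t))\<^sup>2)"
  obtain r where r: "0 \<le> r" "r < 1" "\<And>t. t \<in> {0..1} \<Longrightarrow> tnorm (\<gamma> t) \<le> r"
    using curves_tnorm_bound[OF \<gamma>] by metis
  obtain N where N: "negligible N" "{0, 1} \<subseteq> N"
    "\<And>t. t \<in> {0..1} - N \<Longrightarrow> (\<gamma> has_vector_derivative ?D t) (at t within {0..1})"
    using curves_differentiable_ae[OF \<gamma>] by metis
  have sq: "(tnorm (\<gamma> t))\<^sup>2 \<le> r\<^sup>2" "(tnorm (\<gamma> t))\<^sup>2 < 1" if "t \<in> {0..1}" for t
  proof -
    show "(tnorm (\<gamma> t))\<^sup>2 \<le> r\<^sup>2"
      using r that by (intro power_mono tnorm_nonneg) auto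
    moreover have "r\<^sup>2 < 1"
      using r by (simp add: abs_square_less_1)
    ultimately show "(tnorm (\<gamma> t))\<^sup>2 < 1"
      by simp
  qed
  have "(\<lambda>t. ?D t $ i) absolutely_integrable_on {0..1}" for i
  proof (rule absolutely_integrable_derivative_abs_continuous[OF _ _ N(1)])
    show "abs_continuous_on_Icc 0 1 (\<lambda>t. \<gamma> t $ i)"
      using \<gamma> by (simp add: curves_def)
    show "((\<lambda>t. \<gamma> t $ i) has_vector_derivative ?D t $ i) (at t within {0..1})" if "t \<in> {0..1} - N" for t
      using bounded_linear.has_vector_derivative[OF bounded_linear_vec_nth N(3)[OF that]] .
  qed simp
  then have "(\<lambda>t. \<bar>?D t $ i\<bar>) absolutely_integrable_on {0..1}" for i
    by (rule set_integrable_abs)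
  then have "(\<lambda>t. tnorm (?D t)) absolutely_integrable_on {0..1}"
    unfolding tnorm_def by (intro absolutely_integrable_sum) auto
  moreover have cont: "continuous_on {0..1} ?w"
  proof (intro continuous_on_divide continuous_on_diff continuous_on_power continuous_on_const
      continuous_on_tnorm curves_continuous_on[OF \<gamma>] ballI)
    show "1 - (tnorm (\<gamma> t))\<^sup>2 \<noteq> 0" if "t \<in> {0..1}" for t
      using sq(2)[OF that] by simp
  qed
  have "?w \<in> borel_measurable (lebesgue_on {0..1})"
    by (rule continuous_imp_measurable_on_sets_lebesgue[OF cont]) simp
  moreover have "bounded (?w ` {0..1})"
    by (intro compact_imp_bounded compact_continuous_image cont) simp
  ultimately have "(\<lambda>t. ?w t * tnorm (?D t)) absolutely_integrable_on {0..1}"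
    by (intro absolutely_integrable_bounded_measurable_product_real) auto
  then show ?thesis
    by simp
qed

theorem path_dist_le_curve_length:
  assumes \<gamma>: "\<gamma> \<in> curves p q"
  shows "path_dist p q \<le> curve_length \<gamma>"
proof -
  let ?D = "\<lambda>t. vector_derivative \<gamma> (at t within {0..1})"
  let ?g = "\<lambda>t. tnorm (?D t) / (1 - (tnorm (\<gamma> t))\<^sup>2)"
  define \<phi> where "\<phi> = (\<lambda>t. path_dist p (\<gamma> t))"
  obtain r where r: "0 \<le> r" "r < 1" "\<And>t. t \<in> {0..1} \<Longrightarrow> tnorm (\<gamma> t) \<le> r"
    using curves_tnorm_bound[OF \<gamma>] by metis
  obtain N where N: "negligible N" "{0, 1} \<subseteq> N"
    "\<And>t. t \<in> {0..1} - N \<Longrightarrow> (\<gamma> has_vector_derivative ?D t) (at t within {0..1})"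
    using curves_differentiable_ae[OF \<gamma>] by metis
  have ac: "abs_continuous_on_Icc 0 1 \<phi>"
  proof (rule abs_continuous_on_Icc_dominated[where I = UNIV and f = "\<lambda>i t. \<gamma> t $ i" and C = "1 / (1 - r\<^sup>2)"])
    show "\<bar>\<phi> v - \<phi> u\<bar> \<le> 1 / (1 - r\<^sup>2) * (\<Sum>i\<in>UNIV. \<bar>\<gamma> v $ i - \<gamma> u $ i\<bar>)"
      if "0 \<le> u" "u < v" "v \<le> 1" for u v
      using path_dist_lipschitz[of "\<gamma> v" r "\<gamma> u" p] r that by (simp add: \<phi>_def tnorm_def)
  qed (use \<gamma> in \<open>auto simp: curves_def\<close>)
  define N' where "N' = N \<union> {t \<in> {0<..<1}. \<not> \<phi> differentiable (at t)}"
  have N': "negligible N'"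
    unfolding N'_def using N(1) abs_continuous_differentiable_ae[OF ac] by (intro negligible_Un) auto
  \<comment> \<open>On the null set the value of the length integrand is taken, so that the
    comparison of integrands holds at every point of \<open>{0..1}\<close>.\<close>
  define h where "h = (\<lambda>t. if t \<in> N' then ?g t else vector_derivative \<phi> (at t within {0..1}))"
  have \<phi>': "(\<phi> has_vector_derivative h t) (at t within {0..1})" if t: "t \<in> {0..1} - N'" for t
  proof -
    have "t \<in> {0<..<1}"
      using t N(2) by (cases "t = 0 \<or> t = 1") (auto simp: N'_def)
    then have "\<phi> differentiable (at t)"
      using t by (simp add: N'_def)
    then have "\<phi> differentiable (at t within {0..1})"
      by (rule differentiable_at_withinI)
    then show ?thesis
      using t by (simp add: h_def vector_derivative_works)
  qed
  have h_int: "(h has_integral (\<phi> 1 - \<phi> 0)) {0..1}"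
    by (rule fundamental_theorem_of_calculus_abs_continuous[OF ac _ N' \<phi>']) auto
  have eq: "\<phi> 1 - \<phi> 0 = path_dist p q"
    using \<gamma> by (simp add: \<phi>_def curves_def path_dist_self)
  have g_int: "(?g has_integral curve_length \<gamma>) {0..1}"
    using set_lebesgue_integral_eq_integral[OF curve_integrand_absolutely_integrable[OF \<gamma>]]
    by (simp add: curve_length_def has_integral_integral)
  have "h t \<le> ?g t" if t: "t \<in> {0..1}" for t
  proof (cases "t \<in> N'")
    case False
    then show ?thesis
      using \<phi>'[of t] N(3)[of t] t \<gamma> unfolding \<phi>_def N'_def
      by (intro path_dist_derivative_le[where p = p and S = "{0..1}"])
        (auto simp: curves_def \<phi>_def N'_def trivial_limit_within islimpt_Icc)
  qed (simp add: h_def)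
  then show ?thesis
    unfolding eq[symmetric] by (rule has_integral_le[OF h_int g_int])
qed

section \<open>The path through the minimal point\<close>

lemma abs_radial_le_convex:
  assumes "radial_le x y" "0 \<le> c" "c \<le> 1"
  shows "\<bar>x + c * (y - x)\<bar> = \<bar>x\<bar> + c * (\<bar>y\<bar> - \<bar>x\<bar>)"
proof -
  have "0 \<le> x + c * (y - x)" if "0 \<le> x" "x \<le> y"
    using that assms(2) by simp
  moreover have "x + c * (y - x) \<le> 0" if "y \<le> x" "x \<le> 0"
    using that assms(2) mult_nonneg_nonpos[of c "y - x"] by simp
  ultimately show ?thesis
    using assms(1) by (auto simp: radial_le_def algebra_simps)
qed

text \<open>No coordinate changes sign on the segment, so the norm is affine along it.\<close>

lemma tnorm_orthant_le_convex:
  assumes "orthant_le x y" "0 \<le> c" "c \<le> 1"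
  shows "tnorm (x + c *\<^sub>R (y - x)) = tnorm x + c * (tnorm y - tnorm x)"
  using assms unfolding orthant_le_def tnorm_def
  by (simp add: abs_radial_le_convex sum.distrib sum_subtractf flip: sum_distrib_left)

lemma tnorm_scaleR: "tnorm (c *\<^sub>R x) = \<bar>c\<bar> * tnorm x"
  by (simp add: tnorm_def abs_mult sum_distrib_left)

text \<open>The cut-off factors put both segments into one formula: the first moves from
  \<open>p\<close> to the minimal point, reached at \<open>t = 1 / 2\<close>, and the second
  continues to \<open>q\<close>.\<close>

definition minimal_path :: "real ^ 'n \<Rightarrow> real ^ 'n \<Rightarrow> real \<Rightarrow> real ^ 'n" where
  "minimal_path p q t = minimal_point p q + max 0 (1 - 2 * t) *\<^sub>R (p - minimal_point p q)
    + max 0 (2 * t - 1) *\<^sub>R (q - minimal_point p q)"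

lemma tnorm_minimal_path:
  assumes "0 \<le> t" "t \<le> 1"
  shows "tnorm (minimal_path p q t) = tnorm (minimal_point p q)
    + max 0 (1 - 2 * t) * (tnorm p - tnorm (minimal_point p q))
    + max 0 (2 * t - 1) * (tnorm q - tnorm (minimal_point p q))"
proof (cases "t \<le> 1 / 2")
  case True
  then have "max 0 (1 - 2 * t) = 1 - 2 * t" "max 0 (2 * t - 1) = 0"
    by simp_all
  then show ?thesis
    using assms True tnorm_orthant_le_convex[OF orthant_le_minimal_point1, of "1 - 2 * t" p q]
    by (simp add: minimal_path_def)
next
  case False
  then have "max 0 (1 - 2 * t) = 0" "max 0 (2 * t - 1) = 2 * t - 1"
    by simp_all
  then show ?thesis
    using assms False tnorm_orthant_le_convex[OF orthant_le_minimal_point2, of "2 * t - 1" p q]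
    by (simp add: minimal_path_def)
qed

lemma minimal_path_in_curves:
  assumes "p \<in> tball" "q \<in> tball"
  shows "minimal_path p q \<in> curves p q"
proof -
  let ?m = "minimal_point p q"
  have "minimal_path p q t \<in> tball" if "0 \<le> t" "t \<le> 1" for t
  proof -
    have "tnorm ?m \<le> tnorm p" "tnorm ?m \<le> tnorm q"
      by (simp_all add: tnorm_orthant_le orthant_le_minimal_point)
    then have "(1 - 2 * t) * (tnorm p - tnorm ?m) \<le> 1 * (tnorm p - tnorm ?m)"
      "(2 * t - 1) * (tnorm q - tnorm ?m) \<le> 1 * (tnorm q - tnorm ?m)"
      using that by (intro mult_right_mono; simp)+
    then have "tnorm (minimal_path p q t) \<le> max (tnorm p) (tnorm q)"
      unfolding tnorm_minimal_path[OF that] using \<open>tnorm ?m \<le> tnorm p\<close> by (auto simp: max_def)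
    then show ?thesis
      using assms by (auto simp: tball_def)
  qed
  moreover have "abs_continuous_on_Icc 0 1 (\<lambda>t. minimal_path p q t $ i)" for i
  proof (rule abs_continuous_on_Icc_lipschitz)
    fix u v :: real
    assume "u < v"
    let ?a = "p $ i - ?m $ i" and ?b = "q $ i - ?m $ i"
    have "\<bar>minimal_path p q v $ i - minimal_path p q u $ i\<bar>
        = \<bar>(max 0 (1 - 2 * v) - max 0 (1 - 2 * u)) * ?a + (max 0 (2 * v - 1) - max 0 (2 * u - 1)) * ?b\<bar>"
      by (simp add: minimal_path_def algebra_simps)
    also have "\<dots> \<le> \<bar>max 0 (1 - 2 * v) - max 0 (1 - 2 * u)\<bar> * \<bar>?a\<bar> + \<bar>max 0 (2 * v - 1) - max 0 (2 * u - 1)\<bar> * \<bar>?b\<bar>"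
      using abs_triangle_ineq by (simp flip: abs_mult)
    also have "\<dots> \<le> (2 * (v - u)) * \<bar>?a\<bar> + (2 * (v - u)) * \<bar>?b\<bar>"
      using \<open>u < v\<close> by (intro add_mono mult_right_mono) (auto simp: max_def)
    also have "\<dots> = (2 * \<bar>?a\<bar> + 2 * \<bar>?b\<bar>) * (v - u)"
      by (simp add: algebra_simps)
    finally show "\<bar>minimal_path p q v $ i - minimal_path p q u $ i\<bar> \<le> (2 * \<bar>?a\<bar> + 2 * \<bar>?b\<bar>) * (v - u)" .
  qed
  ultimately show ?thesis
    by (auto simp: curves_def) (simp_all add: minimal_path_def)
qed

lemma curve_length_minimal_path:
  assumes "p \<in> tball" "q \<in> tball"
  shows "curve_length (minimal_path p q) = path_dist p q"
proof -
  let ?\<gamma> = "minimal_path p q"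
  let ?g = "\<lambda>t. tnorm (vector_derivative ?\<gamma> (at t within {0..1})) / (1 - (tnorm (?\<gamma> t))\<^sup>2)"
  define m where "m = minimal_point p q"
  define a where "a = tnorm p - tnorm m"
  define b where "b = tnorm q - tnorm m"
  \<comment> \<open>A primitive of the length integrand on both halves: the norm decreases on the
    first half, hence the minus sign, and increases on the second.\<close>
  define \<Phi> where "\<Phi> = (\<lambda>t. artanh (tnorm m + max 0 (2 * t - 1) * b) - artanh (tnorm m + max 0 (1 - 2 * t) * a))"
  have ab: "tnorm (p - m) = a" "tnorm (q - m) = b" "0 \<le> a" "0 \<le> b"
    unfolding a_def b_def m_def
    by (simp_all add: tnorm_diff_orthant_le tnorm_orthant_le orthant_le_minimal_point)
  have lt: "tnorm m + a < 1" "tnorm m + b < 1"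
    using assms by (simp_all add: a_def b_def tball_def)
  have bound: "tnorm m + c * d \<in> {-1<..<1}" if "0 \<le> c" "c \<le> 1" "0 \<le> d" "tnorm m + d < 1" for c d
  proof -
    have "0 \<le> c * d" "c * d \<le> d"
      using that by (simp_all add: mult_left_le_one_le)
    then show ?thesis
      using that tnorm_nonneg[of m] unfolding greaterThanLessThan_iff by linarith
  qed
  \<comment> \<open>The corner at \<open>1 / 2\<close> and the end points are exempt; the
    fundamental theorem tolerates finitely many exceptions for continuous
    \<open>\<Phi>\<close>.\<close>
  have \<Phi>': "(\<Phi> has_vector_derivative ?g t) (at t)" if t: "t \<in> {0..1} - {0, 1 / 2, 1}" for t
  proof (cases "t < 1 / 2")
    case True
    then have t': "t \<in> {0<..<1 / 2}"
      using t by auto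
    have tn: "tnorm (- 2 *\<^sub>R (p - m)) = 2 * a"
      unfolding tnorm_scaleR ab by simp
    have "((\<lambda>t. m + (1 - 2 * t) *\<^sub>R (p - m)) has_vector_derivative - 2 *\<^sub>R (p - m)) (at t)"
      by (auto intro!: derivative_eq_intros)
    then have "(?\<gamma> has_vector_derivative - 2 *\<^sub>R (p - m)) (at t)"
      by (rule has_vector_derivative_transform_within_open[where S = "{0<..<1 / 2}"])
        (use t' in \<open>auto simp: minimal_path_def m_def\<close>)
    then have "vector_derivative ?\<gamma> (at t within {0..1}) = - 2 *\<^sub>R (p - m)"
      using t' by (intro vector_derivative_at_within_ivl) auto
    then have g: "?g t = 2 * a / (1 - (tnorm m + (1 - 2 * t) * a)\<^sup>2)"
      using t' tnorm_minimal_path[of t p q] tn by (simp add: a_def m_def)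
    have "((\<lambda>t. artanh (tnorm m) - artanh (tnorm m + (1 - 2 * t) * a)) has_real_derivative ?g t) (at t)"
      unfolding g using bound[of "1 - 2 * t" a] t' ab lt
      by (auto intro!: derivative_eq_intros artanh_real_has_field_derivative[THEN DERIV_chain2])
    then have "((\<lambda>t. artanh (tnorm m) - artanh (tnorm m + (1 - 2 * t) * a)) has_vector_derivative ?g t) (at t)"
      by (simp add: has_real_derivative_iff_has_vector_derivative)
    then show ?thesis
      by (rule has_vector_derivative_transform_within_open[where S = "{0<..<1 / 2}"])
        (use t' in \<open>auto simp: \<Phi>_def\<close>)
  next
    case False
    then have t': "t \<in> {1 / 2<..<1}"
      using t by auto
    have tn: "tnorm (2 *\<^sub>R (q - m)) = 2 * b"
      unfolding tnorm_scaleR ab by simp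
    have "((\<lambda>t. m + (2 * t - 1) *\<^sub>R (q - m)) has_vector_derivative 2 *\<^sub>R (q - m)) (at t)"
      by (auto intro!: derivative_eq_intros)
    then have "(?\<gamma> has_vector_derivative 2 *\<^sub>R (q - m)) (at t)"
      by (rule has_vector_derivative_transform_within_open[where S = "{1 / 2<..<1}"])
        (use t' in \<open>auto simp: minimal_path_def m_def\<close>)
    then have "vector_derivative ?\<gamma> (at t within {0..1}) = 2 *\<^sub>R (q - m)"
      using t' by (intro vector_derivative_at_within_ivl) auto
    then have g: "?g t = 2 * b / (1 - (tnorm m + (2 * t - 1) * b)\<^sup>2)"
      using t' tnorm_minimal_path[of t p q] tn by (simp add: b_def m_def)
    have "((\<lambda>t. artanh (tnorm m + (2 * t - 1) * b) - artanh (tnorm m)) has_real_derivative ?g t) (at t)"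
      unfolding g using bound[of "2 * t - 1" b] t' ab lt
      by (auto intro!: derivative_eq_intros artanh_real_has_field_derivative[THEN DERIV_chain2])
    then have "((\<lambda>t. artanh (tnorm m + (2 * t - 1) * b) - artanh (tnorm m)) has_vector_derivative ?g t) (at t)"
      by (simp add: has_real_derivative_iff_has_vector_derivative)
    then show ?thesis
      by (rule has_vector_derivative_transform_within_open[where S = "{1 / 2<..<1}"])
        (use t' in \<open>auto simp: \<Phi>_def\<close>)
  qed
  have "continuous_on {0..1} \<Phi>"
    unfolding \<Phi>_def using bound ab lt
    by (intro continuous_on_diff continuous_on_artanh' continuous_on_add continuous_on_mult
        continuous_on_max continuous_on_const continuous_on_id) auto
  then have "(?g has_integral (\<Phi> 1 - \<Phi> 0)) {0..1}"
    using \<Phi>' by (intro fundamental_theorem_of_calculus_strong[of "{0, 1 / 2, 1}"]) auto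
  moreover have "\<Phi> 1 - \<Phi> 0 = path_dist p q"
    by (simp add: \<Phi>_def path_dist_def a_def b_def m_def)
  ultimately have "(?g has_integral path_dist p q) {0..1}"
    by simp
  then show ?thesis
    using set_lebesgue_integral_eq_integral(2)[OF
        curve_integrand_absolutely_integrable[OF minimal_path_in_curves[OF assms]]]
    by (simp add: curve_length_def integral_unique)
qed

section \<open>Distance, intervals and medians\<close>

theorem tdist_eq_path_dist:
  assumes "p \<in> tball" "q \<in> tball"
  shows "tdist p q = path_dist p q"
  unfolding tdist_def
proof (rule cInf_eq_minimum)
  show "path_dist p q \<in> curve_length ` curves p q"
    using curve_length_minimal_path[OF assms] minimal_path_in_curves[OF assms] by force
qed (auto intro: path_dist_le_curve_length)

lemma mem_tinterval_iff:
  assumes "p \<in> tball" "q \<in> tball"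
  shows "x \<in> tinterval p q \<longleftrightarrow> orthant_le (minimal_point p q) x \<and> (orthant_le x p \<or> orthant_le x q)"
proof (cases "x \<in> tball")
  case True
  then show ?thesis
    using path_dist_between_iff[OF assms True] assms by (simp add: tinterval_def tdist_eq_path_dist)
next
  \<comment> \<open>The ball is closed downwards in the order, so both sides are false.\<close>
  case False
  then show ?thesis
    using assms tball_orthant_le by (auto simp: tinterval_def)
qed

theorem theorem5p4:
  fixes p q s :: "real ^ 'n"
  assumes "CARD('n) \<ge> 2"
    and "p \<in> tball" and "q \<in> tball" and "s \<in> tball"
  shows "(minimal_point p s = minimal_point q s \<longrightarrow>
            supports_median p q s \<and> median p q s = minimal_point p q) \<and>
         (minimal_point p q \<noteq> minimal_point p s \<and> minimal_point p q \<noteq> minimal_point q s \<and>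
          minimal_point p s \<noteq> minimal_point q s \<longrightarrow>
            \<not> supports_median p q s)"
proof -
  let ?I = "tinterval p q \<inter> tinterval q s \<inter> tinterval s p"
  note mem = mem_tinterval_iff[OF assms(2,3)] mem_tinterval_iff[OF assms(3,4)] 
    mem_tinterval_iff[OF assms(4,2), unfolded minimal_point_commute[of s p]]
  note le = orthant_le_minimal_point orthant_le_refl
  have eq: "x = minimal_point a b" if "orthant_le (minimal_point a b) x" "orthant_le x a" "orthant_le x b"
    for a b x :: "real ^ 'n"
    using that by (intro orthant_le_antisym orthant_le_minimal_pointI)
  \<comment> \<open>For each of the three pairs \<open>x\<close> lies below one of its members,
    hence below at least two of the three points. It also lies above their minimal point and
    therefore equals it.\<close>
  have center: "x = minimal_point p q \<or> x = minimal_point q s \<or> x = minimal_point p s" if "x \<in> ?I" for x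
    using that eq[of p q x] eq[of q s x] eq[of p s x] unfolding Int_iff mem by blast
  have min_le: "orthant_le (minimal_point p q) x" "orthant_le (minimal_point q s) x" 
    "orthant_le (minimal_point p s) x" if "x \<in> ?I" for x
    using that unfolding Int_iff mem by blast+
  have "supports_median p q s \<and> median p q s = minimal_point p q"
    if ps: "minimal_point p s = minimal_point q s"
  proof -
    \<comment> \<open>The common value lies below \<open>p\<close> and below \<open>q\<close>, hence
      below their meet.\<close>
    have le_pq: "orthant_le (minimal_point p s) (minimal_point p q)"
      using le ps by (metis orthant_le_minimal_pointI)
    then have "minimal_point p q \<in> ?I"
      unfolding Int_iff mem using le ps by (metis minimal_point_commute)
    moreover have "x = minimal_point p q" if "x \<in> ?I" for x
      using center[OF that] min_le(1)[OF that] le_pq ps by (metis orthant_le_antisym)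
    ultimately have "\<exists>!w. w \<in> ?I" "(THE w. w \<in> ?I) = minimal_point p q"
      by (blast, intro the_equality)
    then show ?thesis
      by (simp add: supports_median_def median_def)
  qed
  moreover have "?I = {}"
    if "minimal_point p q \<noteq> minimal_point p s" "minimal_point p q \<noteq> minimal_point q s"
      "minimal_point p s \<noteq> minimal_point q s"
  proof (rule ccontr)
    assume "?I \<noteq> {}"
    then obtain x where x: "x \<in> ?I" by blast
    \<comment> \<open>From \<open>minimal_point a b\<close> below \<open>x\<close>, and
      \<open>x\<close> below \<open>c\<close>, it follows that \<open>minimal_point a b\<close> lies
      below both \<open>a\<close> and \<open>c\<close>. Exchanging \<open>b\<close> and
      \<open>c\<close> gives the reverse relation, so two of the minimal points coincide.\<close>
    have "orthant_le (minimal_point a b) (minimal_point a c)" 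
      if "orthant_le (minimal_point a b) x" "x = minimal_point b c" for a b c
      using that le by (metis orthant_le_minimal_pointI orthant_le_trans)
    then show False
      using center[OF x] min_le[OF x] that by (metis minimal_point_commute orthant_le_antisym)
  qed
  ultimately show ?thesis
    unfolding supports_median_def by blast
qed

end
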